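(* Let $\mathbb F$ be a field of characteristic $p$, $S=\{R_0,\dots,R_d\}$ a quasi-thin scheme on $X$, $x\in X$, $\mathcal T=\mathcal T(x)$, and let $M_n(\mathbb F)$ denote the full matrix algebra of $n\times n$ matrices over $\mathbb F$. (i) If $S$ is thin, then $\mathcal T\cong M_{|X|}(\mathbb F)$ as $\mathbb F$-algebras. (ii) Suppose $S$ is not thin. Set $\mathcal A_i=\{a: R_a\in S,\ k_a=i\}$ for $i\in\{1,2\}$, and define a binary relation $\sim$ on $\mathcal A_2$ by: $b\sim c$ if and only if $|R_{b'}R_c|=2$ or $(b,c)$ is a bad pair of $S$. Then $\sim$ is an equivalence relation on $\mathcal A_2$. Let $\mathcal C_0,\dots,\mathcal C_\gamma$ be all pairwise distinct equivalence classes of $\sim$. (a) If $p\neq 2$, there exist minimal two-sided ideals $\mathcal I_{-1},\mathcal I_0,\dots,\mathcal I_\gamma$ of $\mathcal T$ such that: (a1) each $\mathcal I_j$, $j\in\{-1,0,\dots,\gamma\}$, is a unital $\mathbb F$-algebra; (a2) $\mathcal I_{-1}$ is a simple $\mathbb F$-algebra of $\mathbb F$-dimension $(d+1)^2$; (a3) as $\mathbb F$-algebras, $\mathcal T=\mathcal I_{-1}\oplus\bigoplus_{k=0}^{\gamma}\mathcal I_k\cong \mathcal I_{-1}\oplus\bigoplus_{k=0}^{\gamma}M_{|\mathcal C_k|}(\mathbb F)$. (b) If $p=2$, let $\mathcal J$ be the Jacobson radical of $\mathcal T$. Then there exist minimal two-sided ideals $\mathcal K_{-1},\mathcal K_0,\dots,\mathcal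 K_\gamma$ of $\mathcal T/\mathcal J$ such that: (b1) each $\mathcal K_u$, $u\in\{-1,0,\dots,\gamma\}$, is a unital $\mathbb F$-algebra; (b2) as $\mathbb F$-algebras, $\mathcal T/\mathcal J=\mathcal K_{-1}\oplus\bigoplus_{v=0}^{\gamma}\mathcal K_v\cong M_{|\mathcal A_1|}(\mathbb F)\oplus\bigoplus_{v=0}^{\gamma}M_{|\mathcal C_v|}(\mathbb F)$.
   Context: Let $X$ be a nonempty finite set. A scheme of class $d$ on $X$ is a partition $S=\{R_0,\dots,R_d\}$ of $X\times X$ into nonempty sets such that $R_0=\{(b,b):b\in X\}$; for each $c$ there is $c'$ with $R_{c'}=\{(f,e):(e,f)\in R_c\}$; and for all $i,j,k$ the intersection number $p_{ij}^k=|\{\ell\in X:(m,\ell)\in R_i,(\ell,n)\in R_j\}|$ does not depend on $(m,n)\in R_k$. The valency of $R_a$ is $k_a=p_{aa'}^0$; $S$ is thin if all $k_a=1$, quasi-thin if all $k_a\le 2$. Complex product: $R_aR_b=\{R_c\in S:p_{ab}^c>0\}$. For $y\in X$, $yR_a=\{z:(y,z)\in R_a\}$. $A_a\in M_X(\mathbb F)$ is the $(0,1)$ adjacency matrix of $R_a$ and $E_a^*(y)$ is the diagonal $(0,1)$-matrix with ones exactly at positions indexed by $yR_a$. The Terwilliger $\mathbb F$-algebra $\mathcal T(y)$ is the $\mathbb F$-subalgebra of $M_X(\mathbb F)$ generated by $A_0,\dots,A_d,E_0^*(y),\dots,E_d^*(y)$. Bad pair: $(u,v)$ is a bad pair of $S$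 if there exist an integer $a\ge1$ and $R_{i_b},R_{j_b},R_{\ell_b}\in S$ ($b=0,\dots,a$) with $i_0=u$, $\ell_a=v$, $k_{i_b}=k_{\ell_b}=2$ and $p_{i_bj_b}^{\ell_b}=1$ for all $b$, $\ell_c=i_{c+1}$ for $0\le c\le a-1$, and $|R_{u'}R_v|=1$. *)

theory Defs
  imports Complex_Main "HOL-Library.Function_Algebras"
begin

text \<open>A scheme of class d on the finite type 'x (the set X is UNIV) is given by
  the family R 0, ..., R d of relations.\<close>

definition pnum :: "(nat \<Rightarrow> ('x \<times> 'x) set) \<Rightarrow> nat \<Rightarrow> nat \<Rightarrow> 'x \<Rightarrow> 'x \<Rightarrow> nat" where
  "pnum R i j m n = card {l. (m, l) \<in> R i \<and> (l, n) \<in> R j}"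

definition is_scheme :: "(nat \<Rightarrow> ('x::finite \<times> 'x) set) \<Rightarrow> nat \<Rightarrow> bool" where
  "is_scheme R d \<longleftrightarrow>
     (\<forall>i\<le>d. R i \<noteq> {}) \<and>
     (\<forall>i\<le>d. \<forall>j\<le>d. i \<noteq> j \<longrightarrow> R i \<inter> R j = {}) \<and>
     (\<Union>i\<in>{..d}. R i) = UNIV \<and>
     R 0 = Id \<and>
     (\<forall>c\<le>d. \<exists>c'\<le>d. R c' = converse (R c)) \<and>
     (\<forall>i\<le>d. \<forall>j\<le>d. \<forall>k\<le>d. \<forall>m n m' n'. (m, n) \<in> R k \<longrightarrow> (m', n') \<in> R k \<longrightarrow>
         pnum R i j m n = pnum R i j m' n')"

definition inum :: "(nat \<Rightarrow> ('x \<times> 'x) set) \<Rightarrow> nat \<Rightarrow> nat \<Rightarrow> nat \<Rightarrow> nat" where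
  "inum R i j k = (let (m, n) = (SOME mn. mn \<in> R k) in pnum R i j m n)"

definition conv_idx :: "(nat \<Rightarrow> ('x \<times> 'x) set) \<Rightarrow> nat \<Rightarrow> nat \<Rightarrow> nat" where
  "conv_idx R d c = (THE c'. c' \<le> d \<and> R c' = converse (R c))"

definition valency :: "(nat \<Rightarrow> ('x \<times> 'x) set) \<Rightarrow> nat \<Rightarrow> nat \<Rightarrow> nat" where
  "valency R d a = inum R a (conv_idx R d a) 0"

definition thin :: "(nat \<Rightarrow> ('x \<times> 'x) set) \<Rightarrow> nat \<Rightarrow> bool" where
  "thin R d \<longleftrightarrow> (\<forall>a\<le>d. valency R d a = 1)"

definition quasi_thin :: "(nat \<Rightarrow> ('x \<times> 'x) set) \<Rightarrow> nat \<Rightarrow> bool" where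
  "quasi_thin R d \<longleftrightarrow> (\<forall>a\<le>d. valency R d a \<le> 2)"

text \<open>complex product R_a R_b, represented by the set of indices c (indices
  correspond bijectively to the relations R_c)\<close>
definition cprod :: "(nat \<Rightarrow> ('x \<times> 'x) set) \<Rightarrow> nat \<Rightarrow> nat \<Rightarrow> nat \<Rightarrow> nat set" where
  "cprod R d a b = {c. c \<le> d \<and> inum R a b c > 0}"

definition bad_pair :: "(nat \<Rightarrow> ('x \<times> 'x) set) \<Rightarrow> nat \<Rightarrow> nat \<Rightarrow> nat \<Rightarrow> bool" where
  "bad_pair R d u v \<longleftrightarrow>
     (\<exists>(a::nat) (i::nat \<Rightarrow> nat) (j::nat \<Rightarrow> nat) (l::nat \<Rightarrow> nat). a \<ge> 1 \<and>
        (\<forall>b\<le>a. i b \<le> d \<and> j b \<le> d \<and> l b \<le> d \<and>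
                 valency R d (i b) = 2 \<and> valency R d (l b) = 2 \<and>
                 inum R (i b) (j b) (l b) = 1) \<and>
        i 0 = u \<and> l a = v \<and>
        (\<forall>c<a. l c = i (Suc c)) \<and>
        card (cprod R d (conv_idx R d u) v) = 1)"

definition A_set :: "(nat \<Rightarrow> ('x \<times> 'x) set) \<Rightarrow> nat \<Rightarrow> nat \<Rightarrow> nat set" where
  "A_set R d i = {a. a \<le> d \<and> valency R d a = i}"

definition sim_rel :: "(nat \<Rightarrow> ('x \<times> 'x) set) \<Rightarrow> nat \<Rightarrow> nat rel" where
  "sim_rel R d = {(b, c). b \<in> A_set R d 2 \<and> c \<in> A_set R d 2 \<and>
      (card (cprod R d (conv_idx R d b) c) = 2 \<or> bad_pair R d b c)}"

type_synonym ('x, 'a) xmat = "'x \<Rightarrow> 'x \<Rightarrow> 'a"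

definition mmult :: "('x::finite, 'a::field) xmat \<Rightarrow> ('x, 'a) xmat \<Rightarrow> ('x, 'a) xmat" where
  "mmult A B = (\<lambda>i j. \<Sum>k\<in>UNIV. A i k * B k j)"

definition msmult :: "'a::field \<Rightarrow> ('x, 'a) xmat \<Rightarrow> ('x, 'a) xmat" where
  "msmult c A = (\<lambda>i j. c * A i j)"

definition adj_mat :: "(nat \<Rightarrow> ('x \<times> 'x) set) \<Rightarrow> nat \<Rightarrow> ('x, 'a::field) xmat" where
  "adj_mat R a = (\<lambda>m n. if (m, n) \<in> R a then 1 else 0)"

definition dual_idem :: "(nat \<Rightarrow> ('x \<times> 'x) set) \<Rightarrow> 'x \<Rightarrow> nat \<Rightarrow> ('x, 'a::field) xmat" where
  "dual_idem R y a = (\<lambda>m n. if m = n \<and> (y, m) \<in> R a then 1 else 0)"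

inductive_set terwilliger :: "(nat \<Rightarrow> ('x::finite \<times> 'x) set) \<Rightarrow> nat \<Rightarrow> 'x \<Rightarrow> ('x, 'a::field) xmat set"
  for R d y where
  gen_A: "a \<le> d \<Longrightarrow> adj_mat R a \<in> terwilliger R d y"
| gen_E: "a \<le> d \<Longrightarrow> dual_idem R y a \<in> terwilliger R d y"
| add: "A \<in> terwilliger R d y \<Longrightarrow> B \<in> terwilliger R d y \<Longrightarrow> A + B \<in> terwilliger R d y"
| smult: "A \<in> terwilliger R d y \<Longrightarrow> msmult c A \<in> terwilliger R d y"
| mult: "A \<in> terwilliger R d y \<Longrightarrow> B \<in> terwilliger R d y \<Longrightarrow> mmult A B \<in> terwilliger R d y"

record ('a, 'm) falg =
  carrier :: "'m set"
  add :: "'m \<Rightarrow> 'm \<Rightarrow> 'm"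
  mul :: "'m \<Rightarrow> 'm \<Rightarrow> 'm"
  smul :: "'a \<Rightarrow> 'm \<Rightarrow> 'm"
  zero :: "'m"

definition mat_alg :: "('x::finite, 'a::field) xmat set \<Rightarrow> ('a, ('x, 'a) xmat) falg" where
  "mat_alg T = \<lparr>carrier = T, add = (+), mul = mmult, smul = msmult, zero = 0\<rparr>"

definition full_mat_alg :: "nat \<Rightarrow> ('a::field, nat \<Rightarrow> nat \<Rightarrow> 'a) falg" where
  "full_mat_alg n = \<lparr>carrier = {A. \<forall>i j. (n \<le> i \<or> n \<le> j) \<longrightarrow> A i j = 0},
      add = (+),
      mul = (\<lambda>A B i j. if i < n \<and> j < n then (\<Sum>k<n. A i k * B k j) else 0),
      smul = (\<lambda>c A i j. c * A i j),
      zero = 0\<rparr>"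

definition alg_iso :: "('a, 'm) falg \<Rightarrow> ('a, 'n) falg \<Rightarrow> bool" where
  "alg_iso A B \<longleftrightarrow> (\<exists>f. bij_betw f (carrier A) (carrier B) \<and>
     (\<forall>x\<in>carrier A. \<forall>y\<in>carrier A. f (add A x y) = add B (f x) (f y) \<and>
                                   f (mul A x y) = mul B (f x) (f y)) \<and>
     (\<forall>c. \<forall>x\<in>carrier A. f (smul A c x) = smul B c (f x)))"

definition restrict_alg :: "('a, 'm) falg \<Rightarrow> 'm set \<Rightarrow> ('a, 'm) falg" where
  "restrict_alg A I = A\<lparr>carrier := I\<rparr>"

definition subspace_of :: "('a, 'm) falg \<Rightarrow> 'm set \<Rightarrow> bool" where
  "subspace_of A I \<longleftrightarrow> I \<subseteq> carrier A \<and> zero A \<in> I \<and>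
     (\<forall>x\<in>I. \<forall>y\<in>I. add A x y \<in> I) \<and> (\<forall>c. \<forall>x\<in>I. smul A c x \<in> I)"

definition two_sided_ideal :: "('a, 'm) falg \<Rightarrow> 'm set \<Rightarrow> bool" where
  "two_sided_ideal A I \<longleftrightarrow> subspace_of A I \<and>
     (\<forall>a\<in>carrier A. \<forall>x\<in>I. mul A a x \<in> I \<and> mul A x a \<in> I)"

definition left_ideal :: "('a, 'm) falg \<Rightarrow> 'm set \<Rightarrow> bool" where
  "left_ideal A I \<longleftrightarrow> subspace_of A I \<and> (\<forall>a\<in>carrier A. \<forall>x\<in>I. mul A a x \<in> I)"

definition maximal_left_ideal :: "('a, 'm) falg \<Rightarrow> 'm set \<Rightarrow> bool" where
  "maximal_left_ideal A I \<longleftrightarrow> left_ideal A I \<and> I \<noteq> carrier A \<and>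
     (\<forall>J. left_ideal A J \<longrightarrow> I \<subseteq> J \<longrightarrow> J = I \<or> J = carrier A)"

definition minimal_ideal :: "('a, 'm) falg \<Rightarrow> 'm set \<Rightarrow> bool" where
  "minimal_ideal A I \<longleftrightarrow> two_sided_ideal A I \<and> I \<noteq> {zero A} \<and>
     (\<forall>J. two_sided_ideal A J \<longrightarrow> J \<subseteq> I \<longrightarrow> J = {zero A} \<or> J = I)"

definition unital_alg :: "('a, 'm) falg \<Rightarrow> bool" where
  "unital_alg A \<longleftrightarrow> (\<exists>e\<in>carrier A. \<forall>a\<in>carrier A. mul A e a = a \<and> mul A a e = a)"

definition simple_alg :: "('a, 'm) falg \<Rightarrow> bool" where
  "simple_alg A \<longleftrightarrow> carrier A \<noteq> {zero A} \<and>
     (\<exists>x\<in>carrier A. \<exists>y\<in>carrier A. mul A x y \<noteq> zero A) \<and>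
     (\<forall>I. two_sided_ideal A I \<longrightarrow> I = {zero A} \<or> I = carrier A)"

definition jacobson :: "('a, 'm) falg \<Rightarrow> 'm set" where
  "jacobson A = carrier A \<inter> \<Inter>{I. maximal_left_ideal A I}"

definition coset :: "('a, 'm) falg \<Rightarrow> 'm set \<Rightarrow> 'm \<Rightarrow> 'm set" where
  "coset A J a = {add A a j | j. j \<in> J}"

definition quot_alg :: "('a, 'm) falg \<Rightarrow> 'm set \<Rightarrow> ('a, 'm set) falg" where
  "quot_alg A J = \<lparr>carrier = coset A J ` carrier A,
      add = (\<lambda>C D. coset A J (add A (SOME x. x \<in> C) (SOME y. y \<in> D))),
      mul = (\<lambda>C D. coset A J (mul A (SOME x. x \<in> C) (SOME y. y \<in> D))),
      smul = (\<lambda>c C. coset A J (smul A c (SOME x. x \<in> C))),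
      zero = coset A J (zero A)\<rparr>"

inductive_set sum_of_sets :: "('a, 'm) falg \<Rightarrow> 'm set set \<Rightarrow> 'm set" for A Is where
  zero: "zero A \<in> sum_of_sets A Is"
| elem: "I \<in> Is \<Longrightarrow> x \<in> I \<Longrightarrow> x \<in> sum_of_sets A Is"
| add: "x \<in> sum_of_sets A Is \<Longrightarrow> y \<in> sum_of_sets A Is \<Longrightarrow> add A x y \<in> sum_of_sets A Is"

definition internal_direct_sum :: "('a, 'm) falg \<Rightarrow> 'i set \<Rightarrow> ('i \<Rightarrow> 'm set) \<Rightarrow> bool" where
  "internal_direct_sum A Idx K \<longleftrightarrow>
     carrier A = sum_of_sets A (K ` Idx) \<and>
     (\<forall>i\<in>Idx. K i \<inter> sum_of_sets A (K ` (Idx - {i})) = {zero A})"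

end

theory Submission
  imports Defs
begin

text \<open>Every set xR_a has one or two points; let s be the permutation of X interchanging the two points of
  each two-point set. For two-point sets xR_a and xR_b, the relations between their points either all
  coincide or split into the two matchings of the sets, and \<open>\<sim>\<close> is the equivalence relation generated by
  the split pairs. Hence the Terwilliger algebra consists of the matrices commuting with s whose (a, b)
  block is constant unless \<open>a \<sim> b\<close>. It acts on the s-invariant vectors as a full matrix algebra and
  on the s-alternating ones as a sum of full matrix algebras, one for each class. If the
  characteristic is not 2 this representation is faithful. In characteristic 2 one replaces the first
  action by its compression to the one-point sets; then the kernel has cube zero, so it is the
  Jacobson radical.\<close>

section \<open>Matrix algebras\<close>

text \<open>Characteristic 2 is special because the vector with entries 1 and -1 on a two-point set
  is then itself invariant. Between two-point sets the invariant action therefore repeats the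
  alternating one, while the row of a one-point set has two equal entries over a two-point set and
  sums to 0 there. So the invariant action is block triangular, and its compression to the one-point
  sets is the only diagonal part not yet recorded by the alternating action. What remains in the
  kernel has constant blocks and vanishes between one-point sets. In a product of such matrices a
  two-point set contributes every term twice, that is 0, so only one-point sets can be passed
  through, and a product of three has to go from one of them to another.

  Surjectivity onto the product of matrix algebras needs no division by 2 on the alternating side.
  Both characteristics therefore share one argument, applied to the algebra itself or to its
  quotient by the kernel.\<close>

lemma sum_fun_apply: "(\<Sum>i\<in>S. f i) x = (\<Sum>i\<in>S. f i x)"
  by (induction S rule: infinite_finite_induct) auto

lemma full_mat_alg_simps [simp]:
  "carrier (full_mat_alg n) = {A. \<forall>i j. (n \<le> i \<or> n \<le> j) \<longrightarrow> A i j = 0}"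
  "add (full_mat_alg n) = (+)"
  "mul (full_mat_alg n) = (\<lambda>A B i j. if i < n \<and> j < n then (\<Sum>k<n. A i k * B k j) else 0)"
  "smul (full_mat_alg n) = (\<lambda>c A i j. c * A i j)"
  "zero (full_mat_alg n) = 0"
  by (simp_all add: full_mat_alg_def)

lemma full_mat_alg_mul_zero [simp]:
  "mul (full_mat_alg k) 0 B = (0 :: nat \<Rightarrow> nat \<Rightarrow> 'a::field)" "mul (full_mat_alg k) B 0 = (0 :: nat \<Rightarrow> nat \<Rightarrow> 'a::field)"
  by (auto simp: fun_eq_iff)

lemma mat_alg_simps [simp]:
  "carrier (mat_alg T) = T"
  "add (mat_alg T) = (+)"
  "mul (mat_alg T) = mmult"
  "smul (mat_alg T) = msmult"
  "zero (mat_alg T) = 0"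
  by (simp_all add: mat_alg_def)

lemma restrict_alg_simps [simp]:
  "carrier (restrict_alg A I) = I"
  "add (restrict_alg A I) = add A"
  "mul (restrict_alg A I) = mul A"
  "smul (restrict_alg A I) = smul A"
  "zero (restrict_alg A I) = zero A"
  by (simp_all add: restrict_alg_def)

section \<open>Matrix units: simplicity and dimension of full matrix algebras\<close>

definition mat_unit :: "nat \<Rightarrow> nat \<Rightarrow> nat \<Rightarrow> nat \<Rightarrow> 'a::field" where
  "mat_unit s t = (\<lambda>i j. if i = s \<and> j = t then 1 else 0)"

lemma mat_unit_carrier: "s < n \<Longrightarrow> t < n \<Longrightarrow> mat_unit s t \<in> carrier (full_mat_alg n)"
  by (auto simp: mat_unit_def)

lemma mat_unit_expansion:
  assumes "C \<in> carrier (full_mat_alg n)"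
  shows "C = (\<Sum>s<n. \<Sum>t<n. (\<lambda>i j. C s t * mat_unit s t i j))"
proof (intro ext)
  fix i j
  have "(\<Sum>s<n. \<Sum>t<n. (\<lambda>i j. C s t * mat_unit s t i j)) i j
      = (\<Sum>s<n. \<Sum>t<n. if s = i then if t = j then C s t else 0 else 0)"
    by (auto simp: sum_fun_apply mat_unit_def intro!: sum.cong)
  also have "\<dots> = (\<Sum>s<n. if s = i then (\<Sum>t<n. if t = j then C s t else 0) else 0)"
    by (intro sum.cong) auto
  also have "\<dots> = C i j"
    using assms by auto
  finally show "C i j = (\<Sum>s<n. \<Sum>t<n. (\<lambda>i j. C s t * mat_unit s t i j)) i j" ..
qed

lemma sum_closed:
  assumes "0 \<in> L" "\<And>a b. a \<in> L \<Longrightarrow> b \<in> L \<Longrightarrow> a + b \<in> L" "\<And>i. i \<in> S \<Longrightarrow> f i \<in> L"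
  shows "(\<Sum>i\<in>S. f i) \<in> L"
  using assms(3) by (induction S rule: infinite_finite_induct) (auto intro: assms)

text \<open>Multiplying by matrix units on both sides isolates a single entry:
  \<open>E_sp B E_qt = B_pq E_st\<close>. A nonzero entry of \<open>B\<close> thus yields every
  multiple of every matrix unit.\<close>

lemma full_mat_alg_ideal_trivial:
  fixes L :: "(nat \<Rightarrow> nat \<Rightarrow> 'a::field) set"
  assumes L: "two_sided_ideal (full_mat_alg n) L" and B: "B \<in> L" "B \<noteq> 0"
  shows "L = carrier (full_mat_alg n)"
proof
  let ?F = "full_mat_alg n :: ('a, nat \<Rightarrow> nat \<Rightarrow> 'a) falg"
  have sub: "L \<subseteq> carrier ?F" and z: "0 \<in> L" and ad: "\<And>a b. a \<in> L \<Longrightarrow> b \<in> L \<Longrightarrow> a + b \<in> L"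
    and sm: "\<And>c a. a \<in> L \<Longrightarrow> (\<lambda>i j. c * a i j) \<in> L"
    and ml: "\<And>a b. a \<in> carrier ?F \<Longrightarrow> b \<in> L \<Longrightarrow> mul ?F a b \<in> L"
    and mr: "\<And>a b. a \<in> carrier ?F \<Longrightarrow> b \<in> L \<Longrightarrow> mul ?F b a \<in> L"
    using L unfolding two_sided_ideal_def subspace_of_def by auto
  show "L \<subseteq> carrier ?F" by (rule sub)
  from B(2) obtain p q where pq: "B p q \<noteq> 0" by (auto simp: fun_eq_iff)
  with sub B(1) have pqn: "p < n" "q < n" by (fastforce simp: not_le[symmetric])+
  have unit: "(\<lambda>i j. c * mat_unit s t i j) \<in> L" if st: "s < n" "t < n" for c s t
  proof -
    have 1: "mul ?F B (mat_unit q t) = (\<lambda>i j. if j = t then B i q else 0)" (is "?l = ?r")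
    proof (intro ext)
      fix i j
      have *: "(\<Sum>k<n. B i k * mat_unit q t k j) = (\<Sum>k<n. if k = q then (if j = t then B i q else 0) else 0)"
        by (intro sum.cong) (auto simp: mat_unit_def)
      show "?l i j = ?r i j"
        using sub B(1) st pqn unfolding full_mat_alg_simps * by (auto simp: not_less subset_iff)
    qed
    have 2: "mul ?F (mat_unit s p) (\<lambda>i j. if j = t then B i q else 0)
      = (\<lambda>i j. B p q * mat_unit s t i j)" (is "?l = ?r")
    proof (intro ext)
      fix i j
      have *: "(\<Sum>k<n. mat_unit s p i k * (if j = t then B k q else 0))
          = (\<Sum>k<n. if k = p then (if i = s \<and> j = t then B p q else 0) else 0)"
        by (intro sum.cong) (auto simp: mat_unit_def)
      show "?l i j = ?r i j"
        using st pqn unfolding full_mat_alg_simps * by (auto simp: mat_unit_def)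
    qed
    have "mul ?F (mat_unit s p) (mul ?F B (mat_unit q t)) \<in> L"
      by (intro ml mr mat_unit_carrier st pqn B)
    then have "(\<lambda>i j. B p q * mat_unit s t i j) \<in> L" unfolding 1 2 .
    from sm[OF this, of "c / B p q"] show ?thesis using pq by simp
  qed
  show "carrier ?F \<subseteq> L"
  proof
    fix C assume C: "C \<in> carrier ?F"
    have "(\<Sum>s<n. \<Sum>t<n. (\<lambda>i j. C s t * mat_unit s t i j)) \<in> L"
      by (intro sum_closed z ad unit) auto
    with mat_unit_expansion[OF C] show "C \<in> L" by simp
  qed
qed

interpretation xmat: vector_space "msmult :: 'a::field \<Rightarrow> ('x::finite, 'a) xmat \<Rightarrow> ('x, 'a) xmat"
  by standard (auto simp: msmult_def fun_eq_iff algebra_simps)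

text \<open>The preimages of the matrix units form a basis of \<open>K\<close>. Linearity of
  \<open>f\<close> is asked on \<open>K\<close> only, since \<open>f\<close> will be a component map
  of a representation, restricted to one ideal.\<close>

lemma xmat_dim_square:
  fixes K :: "('x::finite, 'a::field) xmat set"
  assumes K: "xmat.subspace K"
    and bij: "bij_betw f K (carrier (full_mat_alg n))"
    and add: "\<And>a b. a \<in> K \<Longrightarrow> b \<in> K \<Longrightarrow> f (a + b) = f a + f b"
    and smul: "\<And>c a. a \<in> K \<Longrightarrow> f (msmult c a) = (\<lambda>i j. c * f a i j)"
  shows "vector_space.dim (msmult :: 'a \<Rightarrow> _) K = n^2"
proof -
  let ?F = "full_mat_alg n :: ('a, nat \<Rightarrow> nat \<Rightarrow> 'a) falg"
  define g where "g = (\<lambda>(s, t). the_inv_into K f (mat_unit s t))"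
  let ?S = "{..<n} \<times> {..<n}"
  have g: "g p \<in> K \<and> f (g p) = mat_unit (fst p) (snd p)" if "p \<in> ?S" for p
  proof -
    have "mat_unit (fst p) (snd p) \<in> f ` K"
      unfolding bij_betw_imp_surj_on[OF bij] using that by (intro mat_unit_carrier) auto
    moreover have "inj_on f K" using bij by (simp add: bij_betw_def)
    ultimately show ?thesis
      unfolding g_def case_prod_beta by (metis f_the_inv_into_f the_inv_into_into subset_refl)
  qed
  have inj: "inj_on g ?S"
  proof (rule inj_onI)
    fix p q assume "p \<in> ?S" "q \<in> ?S" "g p = g q"
    then have "(mat_unit (fst p) (snd p) :: nat \<Rightarrow> nat \<Rightarrow> 'a) (fst p) (snd p)
        = mat_unit (fst q) (snd q) (fst p) (snd p)" using g by metis
    then show "p = q" by (auto simp: mat_unit_def prod_eq_iff split: if_splits)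
  qed
  have f0: "f 0 = 0"
    using add[of 0 0] K xmat.subspace_0 by auto
  have fsum: "f (\<Sum>p\<in>P. msmult (u p) (g p)) = (\<Sum>p\<in>P. (\<lambda>i j. u p * mat_unit (fst p) (snd p) i j))"
    and Ksum: "(\<Sum>p\<in>P. msmult (u p) (g p)) \<in> K"
    if "P \<subseteq> ?S" for P u
  proof -
    have "finite P" using that finite_subset by blast
    then have "f (\<Sum>p\<in>P. msmult (u p) (g p)) = (\<Sum>p\<in>P. (\<lambda>i j. u p * mat_unit (fst p) (snd p) i j))
      \<and> (\<Sum>p\<in>P. msmult (u p) (g p)) \<in> K" using that
    proof (induction P)
      case empty
      then show ?case unfolding sum.empty using f0 K xmat.subspace_0 by metis
    next
      case (insert p P)
      then have *: "msmult (u p) (g p) \<in> K" using g K xmat.subspace_scale by (meson insert_subset)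
      have p: "g p \<in> K" "f (g p) = mat_unit (fst p) (snd p)" using g insert.prems by (meson insert_subset)+
      have P: "f (\<Sum>p\<in>P. msmult (u p) (g p)) = (\<Sum>p\<in>P. (\<lambda>i j. u p * mat_unit (fst p) (snd p) i j))"
        "(\<Sum>p\<in>P. msmult (u p) (g p)) \<in> K" using insert by auto
      show ?case
        unfolding sum.insert[OF insert.hyps] add[OF * P(2)] smul[OF p(1)] P(1) p(2)
        using xmat.subspace_add[OF K * P(2)] by blast
    qed
    then show "f (\<Sum>p\<in>P. msmult (u p) (g p)) = (\<Sum>p\<in>P. (\<lambda>i j. u p * mat_unit (fst p) (snd p) i j))"
      "(\<Sum>p\<in>P. msmult (u p) (g p)) \<in> K" by auto
  qed
  \<comment> \<open>Coefficients can be read off entrywise; this serves the spanning argument as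
    well as independence.\<close>
  have coeff: "(\<Sum>p\<in>?S. (\<lambda>i j. u p * mat_unit (fst p) (snd p) i j)) i j = u (i, j)"
    if "i < n" "j < n" for u :: "nat \<times> nat \<Rightarrow> 'a" and i j
  proof -
    have "(\<Sum>p\<in>?S. (\<lambda>i j. u p * mat_unit (fst p) (snd p) i j)) i j = (\<Sum>p\<in>?S. if p = (i,j) then u p else 0)"
      unfolding sum_fun_apply by (intro sum.cong) (auto simp: mat_unit_def)
    also have "\<dots> = u (i, j)" using that by simp
    finally show ?thesis .
  qed
  show ?thesis
  proof (rule xmat.dim_unique)
    show "g ` ?S \<subseteq> K" using g by auto
    show "K \<subseteq> xmat.span (g ` ?S)"
    proof
      fix M assume M: "M \<in> K"
      then have fM: "f M \<in> carrier ?F" using bij by (auto simp: bij_betw_def)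
      let ?M = "\<Sum>p\<in>?S. msmult (f M (fst p) (snd p)) (g p)"
      have "f ?M = f M"
      proof (intro ext)
        fix i j
        show "f ?M i j = f M i j"
        proof (cases "i < n \<and> j < n")
          case True
          then show ?thesis by (simp only: fsum[OF subset_refl] coeff) auto
        next
          case False
          moreover have "f ?M \<in> carrier ?F"
            unfolding bij_betw_imp_surj_on[OF bij, symmetric] by (intro imageI Ksum subset_refl)
          ultimately show ?thesis using fM by (auto simp: not_less)
        qed
      qed
      then have "M = ?M" using bij M Ksum[OF subset_refl] by (auto simp: bij_betw_def inj_on_def)
      also have "?M \<in> xmat.span (g ` ?S)"
        by (intro xmat.span_sum xmat.span_scale xmat.span_base) auto
      finally show "M \<in> xmat.span (g ` ?S)" .
    qed
    show "xmat.independent (g ` ?S)"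
    proof (rule xmat.independent_if_scalars_zero)
      fix u M assume u: "(\<Sum>M\<in>g ` ?S. msmult (u M) M) = 0" and "M \<in> g ` ?S"
      then obtain i j where M: "M = g (i, j)" "i < n" "j < n" by auto
      from u have "(\<Sum>p\<in>?S. msmult (u (g p)) (g p)) = 0" using inj by (simp add: sum.reindex)
      then have "f (\<Sum>p\<in>?S. msmult (u (g p)) (g p)) = 0" using f0 by simp
      then have "(\<Sum>p\<in>?S. (\<lambda>i j. u (g p) * mat_unit (fst p) (snd p) i j)) i j = 0"
        by (simp only: fsum[OF subset_refl] zero_fun_apply)
      then show "u M = 0" using M by (simp only: coeff)
    qed auto
    show "card (g ` ?S) = n^2" using inj by (simp add: card_image power2_eq_square)
  qed
qed

section \<open>Matrices indexed by an arbitrary finite set\<close>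

definition enum :: "'q set \<Rightarrow> nat \<Rightarrow> 'q" where
  "enum Q = (SOME e. bij_betw e {..<card Q} Q)"

lemma bij_betw_enum: "finite Q \<Longrightarrow> bij_betw (enum Q) {..<card Q} Q"
  unfolding enum_def atLeast0LessThan[symmetric]
  by (rule someI_ex[of "\<lambda>e. bij_betw e {0..<card Q} Q"]) (rule ex_bij_betw_nat_finite)

text \<open>The padding by zeros places the result in \<open>full_mat_alg\<close>. The enumeration
  is arbitrary, but the same for rows and columns, so that products are respected.\<close>

definition enum_mat :: "'q set \<Rightarrow> ('q \<Rightarrow> 'q \<Rightarrow> 'a::field) \<Rightarrow> nat \<Rightarrow> nat \<Rightarrow> 'a" where
  "enum_mat Q M = (\<lambda>i j. if i < card Q \<and> j < card Q then M (enum Q i) (enum Q j) else 0)"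

lemma enum_mat_carrier: "enum_mat Q M \<in> carrier (full_mat_alg (card Q))"
  by (auto simp: enum_mat_def)

lemma enum_mat_eq_iff:
  assumes "finite Q"
  shows "enum_mat Q M = enum_mat Q N \<longleftrightarrow> (\<forall>a\<in>Q. \<forall>b\<in>Q. M a b = N a b)"
proof
  assume eq: "enum_mat Q M = enum_mat Q N"
  show "\<forall>a\<in>Q. \<forall>b\<in>Q. M a b = N a b"
  proof (intro ballI)
    fix a b assume "a \<in> Q" "b \<in> Q"
    then have "a \<in> enum Q ` {..<card Q}" "b \<in> enum Q ` {..<card Q}"
      using bij_betw_enum[OF assms] by (simp_all add: bij_betw_def)
    then obtain i j where "i < card Q" "j < card Q" "a = enum Q i" "b = enum Q j"
      by auto
    then show "M a b = N a b" using fun_cong[OF fun_cong[OF eq, of i], of j]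
      by (simp add: enum_mat_def)
  qed
next
  assume "\<forall>a\<in>Q. \<forall>b\<in>Q. M a b = N a b"
  then show "enum_mat Q M = enum_mat Q N"
    using bij_betw_enum[OF assms] by (auto simp: enum_mat_def fun_eq_iff bij_betw_def)
qed

lemma enum_mat_surj:
  assumes "finite Q" "B \<in> carrier (full_mat_alg (card Q))"
  shows "\<exists>M. enum_mat Q M = B"
proof -
  let ?i = "the_inv_into {..<card Q} (enum Q)"
  have "?i (enum Q i) = i" if "i < card Q" for i
    using bij_betw_enum[OF assms(1)] that by (auto simp: bij_betw_def the_inv_into_f_f)
  then have "enum_mat Q (\<lambda>a b. B (?i a) (?i b)) = B"
    using assms(2) by (auto simp: enum_mat_def fun_eq_iff not_less)
  then show ?thesis by blast
qed

text \<open>Agreement of \<open>P\<close> with the product is asked on \<open>Q\<close> only: the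
  parts of a product of matrices obey a product formula just for indices inside the set
  concerned.\<close>

lemma enum_mat_mult:
  assumes Q: "finite Q" and "\<And>a c. a \<in> Q \<Longrightarrow> c \<in> Q \<Longrightarrow> P a c = (\<Sum>b\<in>Q. M a b * N b c)"
  shows "enum_mat Q P = mul (full_mat_alg (card Q)) (enum_mat Q M) (enum_mat Q N)"
proof (intro ext)
  fix i j
  let ?e = "enum Q"
  show "enum_mat Q P i j = mul (full_mat_alg (card Q)) (enum_mat Q M) (enum_mat Q N) i j"
  proof (cases "i < card Q \<and> j < card Q")
    case True
    have "(\<Sum>b\<in>Q. M (?e i) b * N b (?e j)) = (\<Sum>k<card Q. M (?e i) (?e k) * N (?e k) (?e j))"
      by (rule sum.reindex_bij_betw[OF bij_betw_enum[OF Q], symmetric])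
    moreover have "?e i \<in> Q" "?e j \<in> Q"
      using bij_betw_enum[OF Q] True by (auto simp: bij_betw_def)
    ultimately show ?thesis using True by (simp add: enum_mat_def assms(2))
  qed (auto simp: enum_mat_def)
qed

lemma alg_iso_all_matrices:
  "alg_iso (mat_alg (UNIV :: ('x, 'a) xmat set)) (full_mat_alg (card (UNIV :: 'x::finite set))
     :: ('a::field, nat \<Rightarrow> nat \<Rightarrow> 'a) falg)"
proof -
  let ?Q = "UNIV :: 'x set" and ?f = "enum_mat (UNIV :: 'x set) :: ('x,'a) xmat \<Rightarrow> _"
  have "bij_betw ?f UNIV (carrier (full_mat_alg (card ?Q)))"
    unfolding bij_betw_def
  proof
    show "inj ?f" by (rule injI, subst (asm) enum_mat_eq_iff) auto
    show "range ?f = carrier (full_mat_alg (card ?Q))"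
      using enum_mat_carrier[of ?Q] enum_mat_surj[of ?Q, OF finite] by blast
  qed
  moreover have "?f (mmult M N) = mul (full_mat_alg (card ?Q)) (?f M) (?f N)" for M N
    by (rule enum_mat_mult) (auto simp: mmult_def)
  ultimately show ?thesis
    unfolding alg_iso_def mat_alg_simps
    by - (rule exI[of _ ?f], auto simp: enum_mat_def msmult_def fun_eq_iff)
qed

section \<open>Algebras identified with products of matrix algebras\<close>

text \<open>A homomorphism onto a finite product of full matrix algebras; \<open>block_rep\<close>
  makes it an isomorphism. The algebra is an arbitrary \<open>falg\<close> because the conclusions
  are needed both for an algebra of matrices and for a quotient whose elements are cosets.\<close>

locale block_hom =
  fixes A :: "('a::field, 'm) falg" and Idx :: "'j set" and n :: "'j \<Rightarrow> nat"
    and \<rho> :: "'m \<Rightarrow> 'j \<Rightarrow> nat \<Rightarrow> nat \<Rightarrow> 'a"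
  assumes fin: "finite Idx"
    and n_pos: "j \<in> Idx \<Longrightarrow> 0 < n j"
    and zero_closed: "zero A \<in> carrier A"
    and add_closed: "a \<in> carrier A \<Longrightarrow> b \<in> carrier A \<Longrightarrow> add A a b \<in> carrier A"
    and mul_closed: "a \<in> carrier A \<Longrightarrow> b \<in> carrier A \<Longrightarrow> mul A a b \<in> carrier A"
    and smul_closed: "a \<in> carrier A \<Longrightarrow> smul A c a \<in> carrier A"
    and rep_carrier: "a \<in> carrier A \<Longrightarrow> j \<in> Idx \<Longrightarrow> \<rho> a j \<in> carrier (full_mat_alg (n j))"
    and rep_zero: "j \<in> Idx \<Longrightarrow> \<rho> (zero A) j = 0"
    and rep_add: "a \<in> carrier A \<Longrightarrow> b \<in> carrier A \<Longrightarrow> j \<in> Idx \<Longrightarrow> \<rho> (add A a b) j = \<rho> a j + \<rho> b j"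
    and rep_mul: "a \<in> carrier A \<Longrightarrow> b \<in> carrier A \<Longrightarrow> j \<in> Idx \<Longrightarrow>
      \<rho> (mul A a b) j = mul (full_mat_alg (n j)) (\<rho> a j) (\<rho> b j)"
    and rep_smul: "a \<in> carrier A \<Longrightarrow> j \<in> Idx \<Longrightarrow> \<rho> (smul A c a) j = smul (full_mat_alg (n j)) c (\<rho> a j)"
    and rep_surj: "(\<And>j. j \<in> Idx \<Longrightarrow> B j \<in> carrier (full_mat_alg (n j))) \<Longrightarrow>
      \<exists>a\<in>carrier A. \<forall>j\<in>Idx. \<rho> a j = B j"

locale block_rep = block_hom A Idx n \<rho>
  for A :: "('a::field, 'm) falg" and Idx :: "'j set" and n \<rho> +
  assumes rep_inj: "a \<in> carrier A \<Longrightarrow> b \<in> carrier A \<Longrightarrow> (\<And>j. j \<in> Idx \<Longrightarrow> \<rho> a j = \<rho> b j) \<Longrightarrow> a = b"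
begin

text \<open>The preimage of the factor with index \<open>j\<close>, written as the common kernel of
  the other components.\<close>

definition block :: "'j \<Rightarrow> 'm set" where
  "block j = {a \<in> carrier A. \<forall>i\<in>Idx. i \<noteq> j \<longrightarrow> \<rho> a i = 0}"

lemma block_carrier: "a \<in> block j \<Longrightarrow> a \<in> carrier A"
  by (simp add: block_def)

lemma zero_in_block: "zero A \<in> block j"
  by (simp add: block_def zero_closed rep_zero)

lemma two_sided_ideal_block: "two_sided_ideal A (block j)"
  unfolding two_sided_ideal_def subspace_of_def
proof (intro conjI ballI allI)
  show "block j \<subseteq> carrier A" by (auto simp: block_def)
  show "zero A \<in> block j" by (rule zero_in_block)
next
  fix a b assume "a \<in> block j" "b \<in> block j"
  then show "add A a b \<in> block j" by (simp add: block_def add_closed rep_add)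
next
  fix c a assume "a \<in> block j"
  then show "smul A c a \<in> block j"
    by (auto simp add: block_def smul_closed rep_smul fun_eq_iff)
next
  fix a b assume "a \<in> carrier A" "b \<in> block j"
  then show "mul A a b \<in> block j" "mul A b a \<in> block j"
    by (simp_all add: block_def mul_closed rep_mul del: full_mat_alg_simps)
qed

lemma block_eqI: "a \<in> block j \<Longrightarrow> b \<in> block j \<Longrightarrow> \<rho> a j = \<rho> b j \<Longrightarrow> a = b"
  by (rule rep_inj) (auto simp: block_def, metis)

lemma block_rep_surj:
  assumes "j \<in> Idx" "B \<in> carrier (full_mat_alg (n j))"
  shows "\<exists>a\<in>block j. \<rho> a j = B"
proof -
  have "\<exists>a\<in>carrier A. \<forall>i\<in>Idx. \<rho> a i = (if i = j then B else 0)"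
    using assms by (intro rep_surj) auto
  with assms show ?thesis by (auto simp: block_def)
qed

lemma alg_iso_block:
  assumes j: "j \<in> Idx"
  shows "bij_betw (\<lambda>a. \<rho> a j) (block j) (carrier (full_mat_alg (n j)))"
    and "alg_iso (restrict_alg A (block j)) (full_mat_alg (n j))"
proof -
  show bij: "bij_betw (\<lambda>a. \<rho> a j) (block j) (carrier (full_mat_alg (n j)))"
    unfolding bij_betw_def
  proof
    show "inj_on (\<lambda>a. \<rho> a j) (block j)" by (rule inj_onI) (rule block_eqI)
    show "(\<lambda>a. \<rho> a j) ` block j = carrier (full_mat_alg (n j))"
      using block_rep_surj[OF j] rep_carrier[OF block_carrier j] by blast
  qed
  show "alg_iso (restrict_alg A (block j)) (full_mat_alg (n j))"
    unfolding alg_iso_def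
  proof (intro exI[of _ "\<lambda>a. \<rho> a j"] conjI ballI allI)
    show "bij_betw (\<lambda>a. \<rho> a j) (carrier (restrict_alg A (block j))) (carrier (full_mat_alg (n j)))"
      using bij by simp
  qed (use j block_carrier in \<open>simp_all add: rep_add rep_mul rep_smul\<close>)
qed

text \<open>The image under \<open>\<rho>\<close> is an ideal of a full matrix algebra, since
  multipliers lift by \<open>block_rep_surj\<close>, and that algebra is simple. Taking ideals of
  the block alone serves simplicity of the block and its minimality in \<open>A\<close>.\<close>

lemma block_ideal_trivial:
  assumes j: "j \<in> Idx" and I: "two_sided_ideal (restrict_alg A (block j)) I"
  shows "I = {zero A} \<or> I = block j"
proof (cases "I = {zero A}")
  case False
  let ?F = "full_mat_alg (n j) :: ('a, nat \<Rightarrow> nat \<Rightarrow> 'a) falg"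
  have sub: "I \<subseteq> block j" and z: "zero A \<in> I"
    and ad: "\<And>a b. a \<in> I \<Longrightarrow> b \<in> I \<Longrightarrow> add A a b \<in> I"
    and sm: "\<And>c a. a \<in> I \<Longrightarrow> smul A c a \<in> I"
    and mu: "\<And>a b. a \<in> block j \<Longrightarrow> b \<in> I \<Longrightarrow> mul A a b \<in> I"
      "\<And>a b. a \<in> block j \<Longrightarrow> b \<in> I \<Longrightarrow> mul A b a \<in> I"
    using I unfolding two_sided_ideal_def subspace_of_def by auto
  have Ic: "\<And>a. a \<in> I \<Longrightarrow> a \<in> carrier A" using sub block_carrier by blast
  let ?L = "(\<lambda>a. \<rho> a j) ` I"
  have L: "two_sided_ideal ?F ?L"
    unfolding two_sided_ideal_def subspace_of_def
  proof (intro conjI ballI allI)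
    show "?L \<subseteq> carrier ?F" using sub rep_carrier[OF block_carrier j] by blast
    show "zero ?F \<in> ?L" using z rep_zero[OF j] by (auto intro!: image_eqI[of _ _ "zero A"])
  next
    fix B C assume "B \<in> ?L" "C \<in> ?L"
    then obtain b c where "b \<in> I" "B = \<rho> b j" "c \<in> I" "C = \<rho> c j" by auto
    then show "add ?F B C \<in> ?L" using Ic j ad
      by (intro image_eqI[of _ _ "add A b c"]) (auto simp: rep_add)
  next
    fix c B assume "B \<in> ?L"
    then obtain b where "b \<in> I" "B = \<rho> b j" by auto
    then show "smul ?F c B \<in> ?L" using Ic j sm
      by (intro image_eqI[of _ _ "smul A c b"]) (auto simp: rep_smul)
  next
    fix C B assume "C \<in> carrier ?F" "B \<in> ?L"
    then obtain b c where bc: "b \<in> I" "B = \<rho> b j" "c \<in> block j" "C = \<rho> c j"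
      using block_rep_surj[OF j] by (metis imageE)
    moreover have "b \<in> carrier A" "c \<in> carrier A" using bc sub block_carrier by auto
    ultimately show "mul ?F C B \<in> ?L" "mul ?F B C \<in> ?L"
      using rep_mul[OF _ _ j] mu by (metis imageI)+
  qed
  from False z obtain a where a: "a \<in> I" "a \<noteq> zero A" by blast
  then have "\<rho> a j \<noteq> 0"
    using sub zero_in_block rep_zero[OF j] block_eqI by (metis subsetD)
  with a have eq: "?L = carrier ?F" by (intro full_mat_alg_ideal_trivial[OF L, of "\<rho> a j"]) auto
  have "block j \<subseteq> I"
  proof
    fix b assume b: "b \<in> block j"
    then have "\<rho> b j \<in> ?L" using eq rep_carrier[OF block_carrier j] by blast
    then obtain c where "c \<in> I" "\<rho> b j = \<rho> c j" by auto
    with b sub show "b \<in> I" using block_eqI by (metis subsetD)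
  qed
  with sub show ?thesis by auto
qed simp

text \<open>The unit is the preimage of the identity matrix; it is nonzero because the matrix size
  is positive.\<close>

lemma block_unit:
  assumes j: "j \<in> Idx"
  obtains e where "e \<in> block j" "\<And>a. a \<in> block j \<Longrightarrow> mul A e a = a \<and> mul A a e = a" "e \<noteq> zero A"
proof -
  let ?F = "full_mat_alg (n j) :: ('a, nat \<Rightarrow> nat \<Rightarrow> 'a) falg"
  let ?E = "\<lambda>i k. if i = k \<and> i < n j then 1 else 0 :: 'a"
  have "?E \<in> carrier ?F" by auto
  then obtain e where e: "e \<in> block j" "\<rho> e j = ?E" using block_rep_surj[OF j] by blast
  have E: "mul ?F ?E B = B" "mul ?F B ?E = B" if "B \<in> carrier ?F" for B
  proof -
    have "(\<Sum>k<n j. ?E i k * B k l) = B i l" if "i < n j" for i l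
    proof -
      have "(\<Sum>k<n j. ?E i k * B k l) = (\<Sum>k<n j. if k = i then B k l else 0)"
        using that by (intro sum.cong) auto
      then show ?thesis using that by simp
    qed
    moreover have "(\<Sum>k<n j. B i k * ?E k l) = B i l" if "l < n j" for i l
    proof -
      have "(\<Sum>k<n j. B i k * ?E k l) = (\<Sum>k<n j. if k = l then B i k else 0)"
        using that by (intro sum.cong) auto
      then show ?thesis using that by simp
    qed
    ultimately show "mul ?F ?E B = B" "mul ?F B ?E = B" using that
      unfolding full_mat_alg_simps by (auto simp: fun_eq_iff not_less)
  qed
  have "mul A e a = a \<and> mul A a e = a" if a: "a \<in> block j" for a
  proof -
    have "mul A e a \<in> block j" "mul A a e \<in> block j"
      using two_sided_ideal_block[of j] a e block_carrier unfolding two_sided_ideal_def by blast+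
    moreover have "\<rho> (mul A e a) j = \<rho> a j" "\<rho> (mul A a e) j = \<rho> a j"
      using E[OF rep_carrier[OF block_carrier[OF a] j]] e(2)
        rep_mul[OF block_carrier[OF e(1)] block_carrier[OF a] j]
        rep_mul[OF block_carrier[OF a] block_carrier[OF e(1)] j] by simp_all
    ultimately show ?thesis using a block_eqI by blast
  qed
  moreover have "\<rho> e j 0 0 \<noteq> 0" using e n_pos[OF j] by simp
  then have "e \<noteq> zero A" using rep_zero[OF j] by auto
  ultimately show ?thesis using that e by blast
qed

lemma unital_alg_block: "j \<in> Idx \<Longrightarrow> unital_alg (restrict_alg A (block j))"
  unfolding unital_alg_def by (metis block_unit restrict_alg_simps(1,3))

lemma simple_alg_block: "j \<in> Idx \<Longrightarrow> simple_alg (restrict_alg A (block j))"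
proof -
  assume j: "j \<in> Idx"
  from block_unit[OF j] obtain e where e: "e \<in> block j" "mul A e e = e" "e \<noteq> zero A" by metis
  then have "mul A e e \<noteq> zero A" by simp
  with e show ?thesis
    unfolding simple_alg_def restrict_alg_simps using block_ideal_trivial[OF j] by blast
qed

text \<open>An ideal of \<open>A\<close> lying inside the block is in particular an ideal of the
  block.\<close>

lemma minimal_ideal_block:
  assumes j: "j \<in> Idx"
  shows "minimal_ideal A (block j)"
proof -
  have "two_sided_ideal (restrict_alg A (block j)) J" if "two_sided_ideal A J" "J \<subseteq> block j" for J
    using that block_carrier unfolding two_sided_ideal_def subspace_of_def by auto
  then have "J = {zero A} \<or> J = block j" if "two_sided_ideal A J" "J \<subseteq> block j" for J
    using that block_ideal_trivial[OF j] by blast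
  moreover obtain e where "e \<in> block j" "e \<noteq> zero A" using block_unit[OF j] by blast
  then have "block j \<noteq> {zero A}" by blast
  ultimately show ?thesis
    unfolding minimal_ideal_def using two_sided_ideal_block by blast
qed

lemma internal_direct_sum_block: "internal_direct_sum A Idx block"
proof -
  have carr: "a \<in> carrier A" if "a \<in> sum_of_sets A (block ` J)" for a J
    using that by induction (auto intro: zero_closed add_closed block_carrier)
  \<comment> \<open>Induction on a set \<open>F\<close> outside of which all components vanish: one
    component is lifted to its block and split off, and the remainder is supported on a smaller
    set.\<close>
  have sum: "\<forall>a\<in>carrier A. (\<forall>i\<in>Idx - F. \<rho> a i = 0) \<longrightarrow> a \<in> sum_of_sets A (block ` Idx)"
    if "finite F" "F \<subseteq> Idx" for F
    using that
  proof (induction F)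
    case empty
    have "a = zero A" if "a \<in> carrier A" "\<forall>i\<in>Idx. \<rho> a i = 0" for a
      using that by (intro rep_inj) (auto simp: zero_closed rep_zero)
    then show ?case using sum_of_sets.zero[of A] by (metis Diff_empty)
  next
    case (insert j F)
    show ?case
    proof (intro ballI impI)
      fix a assume a: "a \<in> carrier A" "\<forall>i\<in>Idx - insert j F. \<rho> a i = 0"
      have j: "j \<in> Idx" using insert by auto
      obtain u where u: "u \<in> block j" "\<rho> u j = \<rho> a j"
        using block_rep_surj[OF j] rep_carrier[OF a(1) j] by blast
      have "\<exists>v\<in>carrier A. \<forall>i\<in>Idx. \<rho> v i = (if i = j then 0 else \<rho> a i)"
        using rep_carrier[OF a(1)] by (intro rep_surj) auto
      then obtain v where v: "v \<in> carrier A" "\<And>i. i \<in> Idx \<Longrightarrow> \<rho> v i = (if i = j then 0 else \<rho> a i)"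
        by blast
      have "\<forall>i\<in>Idx - F. \<rho> v i = 0" using v(2) a(2) by auto
      with insert v have "v \<in> sum_of_sets A (block ` Idx)" by blast
      moreover have "u \<in> sum_of_sets A (block ` Idx)"
        using u j by (auto intro: sum_of_sets.elem)
      moreover have "a = add A u v"
        using u v a block_carrier[OF u(1)]
        by (intro rep_inj) (auto simp: add_closed rep_add block_def)
      ultimately show "a \<in> sum_of_sets A (block ` Idx)" by (simp add: sum_of_sets.add)
    qed
  qed
  have rep0: "\<rho> a i = 0" if "i \<in> Idx" "a \<in> sum_of_sets A (block ` (Idx - {i}))" for a i
    using that(2)
  proof induction
    case (add a b)
    then show ?case using carr that(1) rep_add by auto
  qed (use that in \<open>auto simp: rep_zero block_def\<close>)
  show ?thesis
    unfolding internal_direct_sum_def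
  proof (intro conjI ballI subset_antisym subsetI)
    fix a assume "a \<in> carrier A"
    then show "a \<in> sum_of_sets A (block ` Idx)" using sum[OF fin] by auto
  next
    fix i a assume i: "i \<in> Idx" "a \<in> block i \<inter> sum_of_sets A (block ` (Idx - {i}))"
    then have "\<rho> a i = \<rho> (zero A) i" using rep0 rep_zero by auto
    then show "a \<in> {zero A}" using i zero_in_block block_eqI by (metis Int_iff singletonI)
  qed (auto intro: carr zero_in_block sum_of_sets.zero)
qed

end

section \<open>Radical and semisimple quotient\<close>

lemma mmult_assoc: "mmult (mmult A B) C = mmult A (mmult B C)"
proof (intro ext)
  fix i j
  have "mmult (mmult A B) C i j = (\<Sum>l\<in>UNIV. \<Sum>k\<in>UNIV. A i k * B k l * C l j)"
    by (simp add: mmult_def sum_distrib_right)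
  also have "\<dots> = (\<Sum>k\<in>UNIV. \<Sum>l\<in>UNIV. A i k * B k l * C l j)" by (rule sum.swap)
  also have "\<dots> = mmult A (mmult B C) i j"
    by (simp add: mmult_def sum_distrib_left mult.assoc)
  finally show "mmult (mmult A B) C i j = mmult A (mmult B C) i j" .
qed

lemma mmult_add_left: "mmult (A + B) C = mmult A C + mmult B C"
  and mmult_add_right: "mmult C (A + B) = mmult C A + mmult C B"
  and mmult_diff_right: "mmult C (A - B) = mmult C A - mmult C B"
  by (simp_all add: mmult_def fun_eq_iff algebra_simps sum.distrib sum_subtractf)

definition mone :: "('x::finite, 'a::field) xmat" where
  "mone = (\<lambda>i j. if i = j then 1 else 0)"

lemma mmult_mone [simp]: "mmult mone A = A" "mmult A mone = A"
  by (simp_all add: mmult_def mone_def fun_eq_iff if_distrib[of "\<lambda>c. c * _"]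
      if_distrib[of "\<lambda>c. _ * c"] cong: if_cong)

locale mat_block_hom = block_hom "mat_alg T" Idx n \<rho>
  for T :: "('x::finite, 'a::field) xmat set" and Idx :: "'j set" and n \<rho>
begin

lemma in_T:
  "0 \<in> T" "a \<in> T \<Longrightarrow> b \<in> T \<Longrightarrow> a + b \<in> T" "a \<in> T \<Longrightarrow> b \<in> T \<Longrightarrow> mmult a b \<in> T"
  "a \<in> T \<Longrightarrow> msmult c a \<in> T"
  using zero_closed add_closed mul_closed smul_closed by simp_all

lemma rep_plus: "a \<in> T \<Longrightarrow> b \<in> T \<Longrightarrow> j \<in> Idx \<Longrightarrow> \<rho> (a + b) j = \<rho> a j + \<rho> b j"
  using rep_add by simp

lemma diff_eq: "a - b = a + msmult (- 1) b"
  by (simp add: fun_eq_iff msmult_def)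

lemma diff_in_T: "a \<in> T \<Longrightarrow> b \<in> T \<Longrightarrow> a - b \<in> T"
  unfolding diff_eq by (intro in_T)

lemma rep_diff: "a \<in> T \<Longrightarrow> b \<in> T \<Longrightarrow> j \<in> Idx \<Longrightarrow> \<rho> (a - b) j = \<rho> a j - \<rho> b j"
  unfolding diff_eq[of a b] using rep_smul[of b j "- 1"] rep_plus[of a "msmult (- 1) b" j] in_T(4)[of b "- 1"]
  by (simp add: fun_eq_iff)

lemma rep_mmult: "a \<in> T \<Longrightarrow> b \<in> T \<Longrightarrow> j \<in> Idx \<Longrightarrow> \<rho> (mmult a b) j = mul (full_mat_alg (n j)) (\<rho> a j) (\<rho> b j)"
  using rep_mul by (simp del: full_mat_alg_simps)

definition ker :: "('x, 'a) xmat set" where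
  "ker = {a \<in> T. \<forall>j\<in>Idx. \<rho> a j = 0}"

lemma ker_closed:
  "0 \<in> ker" "a \<in> ker \<Longrightarrow> b \<in> ker \<Longrightarrow> a + b \<in> ker" "a \<in> ker \<Longrightarrow> msmult c a \<in> ker"
  "a \<in> T \<Longrightarrow> b \<in> ker \<Longrightarrow> mmult a b \<in> ker"
  using rep_zero
  by (auto simp: ker_def in_T rep_plus rep_smul[simplified] rep_mmult fun_eq_iff
      simp del: full_mat_alg_simps) (auto simp: full_mat_alg_def)

text \<open>\<open>quot_alg\<close> calculates with chosen representatives. The components are
  constant on cosets of \<open>ker\<close>, so the choice does not affect them; and equal components
  put the difference of representatives into \<open>ker\<close>, which gives injectivity.\<close>

lemma block_rep_quot:
  "block_rep (quot_alg (mat_alg T) ker) Idx n (\<lambda>C. \<rho> (SOME a. a \<in> C))"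
proof -
  let ?A = "mat_alg T"
  let ?c = "coset ?A ker"
  let ?s = "\<lambda>C :: ('x, 'a) xmat set. SOME a. a \<in> C"
  have c: "?c a = {a + k | k. k \<in> ker}" for a by (simp add: coset_def)
  have s: "?s (?c a) \<in> T \<and> (\<forall>j\<in>Idx. \<rho> (?s (?c a)) j = \<rho> a j)" if "a \<in> T" for a
  proof -
    have "a \<in> ?c a" unfolding c using ker_closed(1) by (metis (mono_tags, lifting) add.right_neutral mem_Collect_eq)
    then have "?s (?c a) \<in> ?c a" by (rule someI[of "\<lambda>m. m \<in> ?c a"])
    then obtain k where "k \<in> ker" "?s (?c a) = a + k" unfolding c by blast
    then show ?thesis using that by (auto simp: ker_def in_T rep_plus)
  qed
  have eq: "?c a = ?c b" if "a \<in> T" "b \<in> T" "\<And>j. j \<in> Idx \<Longrightarrow> \<rho> a j = \<rho> b j" for a b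
  proof -
    have sub: "?c a \<subseteq> ?c b" if "a \<in> T" "b \<in> T" "\<forall>j\<in>Idx. \<rho> a j = \<rho> b j" for a b
    proof
      fix m assume "m \<in> ?c a"
      then obtain k where k: "k \<in> ker" "m = a + k" unfolding c by blast
      have "a - b \<in> ker" using that by (auto simp: ker_def diff_in_T rep_diff)
      then have "m = b + ((a - b) + k)" "(a - b) + k \<in> ker" using k ker_closed(2) by auto
      then show "m \<in> ?c b" unfolding c by blast
    qed
    from sub[of a b] sub[of b a] that show ?thesis by auto
  qed
  have q: "carrier (quot_alg ?A ker) = ?c ` T" "zero (quot_alg ?A ker) = ?c 0"
    "add (quot_alg ?A ker) C D = ?c (?s C + ?s D)"
    "mul (quot_alg ?A ker) C D = ?c (mmult (?s C) (?s D))"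
    "smul (quot_alg ?A ker) r C = ?c (msmult r (?s C))" for C D r
    by (simp_all add: quot_alg_def)
  have sT: "?s C \<in> T" if "C \<in> ?c ` T" for C using that s by blast
  have cs: "\<rho> (?s (?c a)) j = \<rho> a j" if "a \<in> T" "j \<in> Idx" for a j using that s by blast
  show ?thesis
  proof (unfold_locales, unfold q, goal_cases)
    case 1 show ?case by (rule fin)
  next
    case 2 then show ?case by (rule n_pos)
  next
    case 3 show ?case by (intro imageI in_T)
  next
    case 4 then show ?case by (intro imageI in_T sT)
  next
    case 5 then show ?case by (intro imageI in_T sT)
  next
    case 6 then show ?case by (intro imageI in_T sT)
  next
    case (7 C j)
    then show ?case using rep_carrier[of "?s C" j] sT[of C] by (simp only: mat_alg_simps)
  next
    case (8 j)
    then show ?case using cs[OF in_T(1)] rep_zero by simp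
  next
    case (9 C D j)
    then show ?case by (simp only: cs in_T sT rep_plus)
  next
    case (10 C D j)
    then show ?case by (simp only: cs in_T sT rep_mmult)
  next
    case (11 C j c)
    then show ?case using rep_smul[of "?s C" j c] by (simp only: cs in_T sT mat_alg_simps)
  next
    case (12 B)
    have "\<exists>a\<in>T. \<forall>j\<in>Idx. \<rho> a j = B j" using rep_surj[OF 12] by (simp only: mat_alg_simps)
    then obtain a where "a \<in> T" "\<forall>j\<in>Idx. \<rho> a j = B j" by blast
    then show ?case using cs[of a] by (intro bexI[of _ "?c a"]) auto
  next
    case (13 C D)
    then obtain a b where ab: "a \<in> T" "b \<in> T" "C = ?c a" "D = ?c b" by blast
    then have "\<rho> a j = \<rho> b j" if "j \<in> Idx" for j using 13(3)[OF that] cs that by simp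
    then show ?case unfolding ab(3,4) by (intro eq ab)
  qed
qed

text \<open>Adding a nilpotent ideal to a proper left ideal cannot produce the unit, so every
  maximal left ideal contains \<open>ker\<close>. Conversely, the matrices whose component
  \<open>j\<close> has zero column \<open>t\<close> form a maximal left ideal, and the intersection
  of these over all \<open>j\<close> and \<open>t\<close> is \<open>ker\<close>.\<close>

lemma jacobson_eq_ker:
  assumes one: "mone \<in> T"
    and nil: "\<And>a b c. a \<in> ker \<Longrightarrow> b \<in> ker \<Longrightarrow> c \<in> ker \<Longrightarrow> mmult a (mmult b c) = 0"
  shows "jacobson (mat_alg T) = ker"
proof
  let ?A = "mat_alg T"
  show "ker \<subseteq> jacobson ?A"
  proof
    fix u assume u: "u \<in> ker"
    have "u \<in> L" if L: "maximal_left_ideal ?A L" for L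
    proof (rule ccontr)
      assume "u \<notin> L"
      have LT: "L \<subseteq> T" and L0: "0 \<in> L" and Ladd: "\<And>a b. a \<in> L \<Longrightarrow> b \<in> L \<Longrightarrow> a + b \<in> L"
        and Lsm: "\<And>c a. a \<in> L \<Longrightarrow> msmult c a \<in> L"
        and Lmul: "\<And>a b. a \<in> T \<Longrightarrow> b \<in> L \<Longrightarrow> mmult a b \<in> L" and LneT: "L \<noteq> T"
        and Lmax: "\<And>J. left_ideal ?A J \<Longrightarrow> L \<subseteq> J \<Longrightarrow> J = L \<or> J = T"
        using L by (auto simp: maximal_left_ideal_def left_ideal_def subspace_of_def)
      \<comment> \<open>This left ideal contains \<open>u\<close>, which is not in \<open>L\<close>;
        by maximality of \<open>L\<close> it is all of \<open>T\<close>.\<close>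
      let ?J = "{l + k | l k. l \<in> L \<and> k \<in> ker}"
      have "left_ideal ?A ?J"
        unfolding left_ideal_def subspace_of_def mat_alg_simps
      proof (intro conjI ballI allI)
        show "?J \<subseteq> T" using LT in_T(2) by (auto simp: ker_def subset_iff)
        show "0 \<in> ?J" using L0 ker_closed(1) by (metis (mono_tags, lifting) add.right_neutral mem_Collect_eq)
      next
        fix a b assume "a \<in> ?J" "b \<in> ?J"
        then obtain l k l' k' where *: "a = l + k" "b = l' + k'" "l \<in> L" "l' \<in> L" "k \<in> ker" "k' \<in> ker"
          by blast
        then have "a + b = (l + l') + (k + k')" by simp
        with * Ladd ker_closed(2) show "a + b \<in> ?J" by blast
      next
        fix c a assume "a \<in> ?J"
        then obtain l k where *: "a = l + k" "l \<in> L" "k \<in> ker" by blast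
        then have "msmult c a = msmult c l + msmult c k" by (simp add: xmat.scale_right_distrib)
        with * Lsm ker_closed(3) show "msmult c a \<in> ?J" by blast
      next
        fix t a assume t: "t \<in> T" and "a \<in> ?J"
        then obtain l k where *: "a = l + k" "l \<in> L" "k \<in> ker" by blast
        then have "mmult t a = mmult t l + mmult t k" by (simp add: mmult_add_right)
        with * t Lmul ker_closed(4) show "mmult t a \<in> ?J" by blast
      qed
      moreover have "L \<subseteq> ?J" using ker_closed(1)
        by (metis (mono_tags, lifting) add.right_neutral mem_Collect_eq subsetI)
      moreover have "u \<in> ?J" using L0 u
        by (metis (mono_tags, lifting) add.left_neutral mem_Collect_eq)
      ultimately have "?J = T" using Lmax \<open>u \<notin> L\<close> by blast
      with one obtain l k where lk: "mone = l + k" "l \<in> L" "k \<in> ker" by blast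
      have l: "l = mone - k" unfolding lk(1) by simp
      have kT: "k \<in> T" using lk by (simp add: ker_def)
      \<comment> \<open>the geometric series inverts mone - k\<close>
      let ?g = "mone + k + mmult k k"
      have "mmult ?g l = mone - mmult k (mmult k k)"
        unfolding l by (simp add: mmult_add_left mmult_diff_right mmult_assoc)
      also have "\<dots> = mone" using nil[OF lk(3) lk(3) lk(3)] by simp
      finally have "mone \<in> L" using Lmul[OF _ lk(2), of ?g] in_T one kT by auto
      then have "T \<subseteq> L" using Lmul by fastforce
      with LT LneT show False by blast
    qed
    with u show "u \<in> jacobson ?A" by (auto simp: jacobson_def ker_def)
  qed
  show "jacobson ?A \<subseteq> ker"
  proof
    fix u assume u: "u \<in> jacobson ?A"
    then have uT: "u \<in> T" by (simp add: jacobson_def)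
    have "\<rho> u j s t = 0" if j: "j \<in> Idx" and st: "s < n j" "t < n j" for j s t
    proof -
      let ?F = "full_mat_alg (n j) :: ('a, nat \<Rightarrow> nat \<Rightarrow> 'a) falg"
      \<comment> \<open>the annihilator of a standard basis vector of the j-th simple module\<close>
      let ?L = "{a \<in> T. \<forall>s<n j. \<rho> a j s t = 0}"
      have sur: "\<exists>a\<in>T. \<rho> a j = B" if "B \<in> carrier ?F" for B
      proof -
        have "\<exists>a\<in>carrier ?A. \<forall>i\<in>Idx. \<rho> a i = (if i = j then B else 0)"
          using that by (intro rep_surj) auto
        then show ?thesis using j by (metis mat_alg_simps(1))
      qed
      have mul: "\<rho> (mmult a b) j s t = (\<Sum>k<n j. \<rho> a j s k * \<rho> b j k t)"
        if "a \<in> T" "b \<in> T" "s < n j" for a b s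
        using rep_mmult[OF that(1,2) j] that st by simp
      have lid: "left_ideal ?A ?L"
        unfolding left_ideal_def subspace_of_def mat_alg_simps
        using j rep_zero[OF j]
        by (auto simp: in_T rep_plus rep_smul[simplified] mul)
      have "maximal_left_ideal ?A ?L"
        unfolding maximal_left_ideal_def
      proof (intro conjI allI impI)
        show "left_ideal ?A ?L" by (rule lid)
        obtain a where "a \<in> T" "\<rho> a j = mat_unit t t" using sur[OF mat_unit_carrier[OF st(2) st(2)]] by blast
        then have "a \<in> T" "a \<notin> ?L" using st by (auto simp: mat_unit_def)
        then show "?L \<noteq> carrier ?A" by auto
      next
        fix J assume J: "left_ideal ?A J" "?L \<subseteq> J"
        then have JT: "J \<subseteq> T" and Jadd: "\<And>a b. a \<in> J \<Longrightarrow> b \<in> J \<Longrightarrow> a + b \<in> J"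
          and Jmul: "\<And>a b. a \<in> T \<Longrightarrow> b \<in> J \<Longrightarrow> mmult a b \<in> J"
          by (auto simp: left_ideal_def subspace_of_def)
        show "J = ?L \<or> J = carrier ?A"
        proof (cases "J = ?L")
          case False
          with J(2) JT obtain v r where v: "v \<in> J" "r < n j" "\<rho> v j r t \<noteq> 0" by blast
          then have vT: "v \<in> T" using JT by blast
          have "w \<in> J" if w: "w \<in> T" for w
          proof -
            \<comment> \<open>Only column \<open>r\<close> of \<open>?B\<close> is nonzero. It is
              chosen so that the entry of \<open>v\<close> at \<open>(r, t)\<close> is turned into
              column \<open>t\<close> of \<open>w\<close>; then \<open>w\<close> and the product
              differ by an element of \<open>?L\<close>.\<close>
            let ?B = "\<lambda>i k. if i < n j \<and> k = r then \<rho> w j i t / \<rho> v j r t else 0"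
            have "?B \<in> carrier ?F" using v by auto
            with sur obtain b where b: "b \<in> T" "\<rho> b j = ?B" by blast
            have "\<rho> (mmult b v) j i t = \<rho> w j i t" if i: "i < n j" for i
            proof -
              have "(\<Sum>k<n j. ?B i k * \<rho> v j k t) = (\<Sum>k<n j. if k = r then \<rho> w j i t else 0)"
                using i v by (intro sum.cong) auto
              then show ?thesis using mul[OF b(1) vT i] b(2) v by simp
            qed
            then have "w - mmult b v \<in> ?L"
              using w b vT j by (auto simp: diff_in_T in_T rep_diff)
            then have "w - mmult b v \<in> J" using J(2) by blast
            from Jadd[OF this Jmul[OF b(1) v(1)]] show ?thesis by simp
          qed
          with JT show ?thesis by auto
        qed simp
      qed
      with u have "u \<in> ?L" by (auto simp: jacobson_def)
      with st show ?thesis by auto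
    qed
    moreover have "\<rho> u j s t = 0" if "j \<in> Idx" "\<not> (s < n j \<and> t < n j)" for j s t
      using rep_carrier[of u j] uT that by (auto simp: not_less)
    ultimately have "\<rho> u j = 0" if "j \<in> Idx" for j
      using that by (intro ext) (metis zero_fun_apply)
    then show "u \<in> ker" using uT by (simp add: ker_def)
  qed
qed

end

section \<open>Quasi-thin schemes\<close>

locale qt_scheme =
  fixes R :: "nat \<Rightarrow> ('x::finite \<times> 'x) set" and d :: nat and x :: 'x
  assumes scheme: "is_scheme R d" and qthin: "quasi_thin R d"
begin

definition rel_of :: "'x \<Rightarrow> 'x \<Rightarrow> nat" where
  "rel_of y z = (THE k. k \<le> d \<and> (y, z) \<in> R k)"

abbreviation cv :: "nat \<Rightarrow> nat" where "cv \<equiv> conv_idx R d"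
abbreviation val :: "nat \<Rightarrow> nat" where "val \<equiv> valency R d"

lemma schemeD:
  "i \<le> d \<Longrightarrow> R i \<noteq> {}" "i \<le> d \<Longrightarrow> j \<le> d \<Longrightarrow> i \<noteq> j \<Longrightarrow> R i \<inter> R j = {}" "(\<Union>i\<in>{..d}. R i) = UNIV"
  "R 0 = Id" "i \<le> d \<Longrightarrow> \<exists>c\<le>d. R c = converse (R i)"
  using scheme unfolding is_scheme_def by simp_all

lemma pnum_eq:
  "i \<le> d \<Longrightarrow> j \<le> d \<Longrightarrow> k \<le> d \<Longrightarrow> (m, n) \<in> R k \<Longrightarrow> (m', n') \<in> R k \<Longrightarrow> pnum R i j m n = pnum R i j m' n'"
proof -
  have "\<forall>i\<le>d. \<forall>j\<le>d. \<forall>k\<le>d. \<forall>m n m' n'. (m, n) \<in> R k \<longrightarrow> (m', n') \<in> R k \<longrightarrow>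
      pnum R i j m n = pnum R i j m' n'"
    using scheme unfolding is_scheme_def by (elim conjE)
  then show "i \<le> d \<Longrightarrow> j \<le> d \<Longrightarrow> k \<le> d \<Longrightarrow> (m, n) \<in> R k \<Longrightarrow> (m', n') \<in> R k \<Longrightarrow> ?thesis" by blast
qed

lemma rel_of_unique: "\<exists>!k. k \<le> d \<and> (y, z) \<in> R k"
proof -
  have "(y, z) \<in> (\<Union>i\<in>{..d}. R i)" by (simp add: schemeD)
  then obtain k where "k \<le> d" "(y, z) \<in> R k" by auto
  moreover have "k = k'" if "k \<le> d" "(y, z) \<in> R k" "k' \<le> d" "(y, z) \<in> R k'" for k k'
    using schemeD(2)[of k k'] that by blast
  ultimately show ?thesis by blast
qed

lemma rel_of_le [simp]: "rel_of y z \<le> d" and rel_of_in: "(y, z) \<in> R (rel_of y z)"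
  using theI'[OF rel_of_unique[of y z]] by (auto simp: rel_of_def)

lemma in_R_iff: "k \<le> d \<Longrightarrow> (y, z) \<in> R k \<longleftrightarrow> rel_of y z = k"
  using rel_of_unique[of y z] rel_of_le rel_of_in by metis

lemma rel_of_ex: "k \<le> d \<Longrightarrow> \<exists>y z. rel_of y z = k"
  using schemeD(1)[of k] in_R_iff[of k] by fastforce

lemma rel_of_0_iff: "rel_of y z = 0 \<longleftrightarrow> y = z"
  using in_R_iff[of 0 y z] by (simp add: schemeD)

lemma cv: assumes "k \<le> d" shows "cv k \<le> d" "R (cv k) = converse (R k)"
proof -
  obtain c where c: "c \<le> d" "R c = converse (R k)" using schemeD(5)[OF assms] by blast
  have *: "c' = c" if "c' \<le> d \<and> R c' = converse (R k)" for c'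
    using that c rel_of_ex[of c] in_R_iff by metis
  have "cv k = c"
    unfolding conv_idx_def
  proof (rule the_equality)
    show "c \<le> d \<and> R c = converse (R k)" using c by blast
  qed (rule *)
  then show "cv k \<le> d" "R (cv k) = converse (R k)" using c by blast+
qed

lemma rel_of_eq_cv_iff: "k \<le> d \<Longrightarrow> rel_of z y = cv k \<longleftrightarrow> rel_of y z = k"
  using cv[of k] in_R_iff by (metis converse_iff)

lemma rel_of_swap: "rel_of z y = cv (rel_of y z)"
  by (simp add: rel_of_eq_cv_iff)

lemma pnum_rel_of: "i \<le> d \<Longrightarrow> j \<le> d \<Longrightarrow> pnum R i j m n = card {l. rel_of m l = i \<and> rel_of l n = j}"
  by (simp add: pnum_def in_R_iff)

text \<open>The pair chosen inside \<open>inum\<close> is immaterial by the scheme axiom.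
  Intersection numbers thereby become counts at whichever pair is convenient, usually one starting
  at \<open>x\<close>.\<close>

lemma inum_rel_of:
  assumes "i \<le> d" "j \<le> d"
  shows "inum R i j (rel_of m n) = card {l. rel_of m l = i \<and> rel_of l n = j}"
proof -
  obtain m' n' where mn: "(SOME mn. mn \<in> R (rel_of m n)) = (m', n')" by fastforce
  have "(m', n') \<in> R (rel_of m n)"
    unfolding mn[symmetric] by (rule someI[of "\<lambda>p. p \<in> R (rel_of m n)"], rule rel_of_in)
  then have "pnum R i j m' n' = pnum R i j m n"
    by (rule pnum_eq[OF assms rel_of_le _ rel_of_in])
  then show ?thesis using assms by (simp add: inum_def mn pnum_rel_of)
qed

text \<open>The valency is an intersection number of the diagonal, so it may be evaluated at any
  point; the second condition in the count is the converse of the first.\<close>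

lemma val_eq: assumes "a \<le> d" shows "val a = card {l. rel_of y l = a}"
proof -
  have "rel_of y y = 0" by (simp add: rel_of_0_iff)
  then have "val a = card {l. rel_of y l = a \<and> rel_of l y = cv a}"
    unfolding valency_def using inum_rel_of[of a "cv a" y y] assms cv by simp
  then show ?thesis using assms by (simp add: rel_of_eq_cv_iff)
qed

lemma val_cases: assumes "a \<le> d" shows "val a = 1 \<or> val a = 2"
proof -
  obtain y z where "rel_of y z = a" using rel_of_ex[OF assms] by blast
  then have "{l. rel_of y l = a} \<noteq> {}" by blast
  then have "val a \<noteq> 0" using val_eq[OF assms, of y] by simp
  moreover have "val a \<le> 2" using qthin assms by (simp add: quasi_thin_def)
  ultimately show ?thesis by linarith
qed

abbreviation ix :: "'x \<Rightarrow> nat" where "ix \<equiv> rel_of x"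

lemma ix_ex: "a \<le> d \<Longrightarrow> \<exists>y. ix y = a"
proof -
  assume "a \<le> d"
  then have "card {l. ix l = a} \<noteq> 0" using val_cases[of a] val_eq[of a x] by linarith
  then show ?thesis by (metis (mono_tags, lifting) card.empty Collect_empty_eq)
qed

text \<open>Both counts are the intersection number of \<open>b\<close> and the converse of
  \<open>k\<close>, taken at the pairs \<open>(x, y)\<close> and \<open>(x, y')\<close> of the same
  relation.\<close>

lemma row_card:
  assumes "b \<le> d" "k \<le> d" "ix y = ix y'"
  shows "card {z. ix z = b \<and> rel_of y z = k} = card {z. ix z = b \<and> rel_of y' z = k}"
  using inum_rel_of[of b "cv k" x y] inum_rel_of[of b "cv k" x y'] assms cv[of k]
  by (simp add: rel_of_eq_cv_iff)

lemma col_card: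
  assumes "a \<le> d" "k \<le> d" "ix z = ix z'"
  shows "card {y. ix y = a \<and> rel_of y z = k} = card {y. ix y = a \<and> rel_of y z' = k}"
  using inum_rel_of[of a k x z] inum_rel_of[of a k x z'] assms by simp

section \<open>The involution exchanging the points of each two-point set\<close>

definition swp :: "'x \<Rightarrow> 'x" where
  "swp y = (if \<exists>z. z \<noteq> y \<and> ix z = ix y then SOME z. z \<noteq> y \<and> ix z = ix y else y)"

lemma ix_swp [simp]: "ix (swp y) = ix y"
  unfolding swp_def by (smt (verit) someI_ex)

text \<open>A third point would give valency at least 3. Hence the choice in \<open>swp\<close> is
  forced.\<close>

lemma ix_eq_iff: "ix z = ix y \<longleftrightarrow> z = y \<or> z = swp y"
proof
  assume z: "ix z = ix y"
  show "z = y \<or> z = swp y"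
  proof (rule ccontr)
    assume *: "\<not> (z = y \<or> z = swp y)"
    then have "swp y \<noteq> y" using z unfolding swp_def by (smt (verit) someI_ex)
    with * have "card {y, swp y, z} = 3" by auto
    moreover have "{y, swp y, z} \<subseteq> {l. ix l = ix y}" using z by auto
    ultimately have "3 \<le> val (ix y)" unfolding val_eq[OF rel_of_le, of x y x] by (metis card_mono finite)
    then show False using val_cases[of "ix y"] by auto
  qed
qed auto

lemma block_eq: "{z. ix z = ix y} = {y, swp y}"
  using ix_eq_iff by auto

lemma swp_fixed_iff: "swp y = y \<longleftrightarrow> val (ix y) = 1"
  using val_eq[of "ix y" x] by (auto simp: block_eq card_insert_if)

lemma swp_swp [simp]: "swp (swp y) = y"
proof -
  have "y \<in> {z. ix z = ix (swp y)}" by simp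
  then have "y = swp y \<or> y = swp (swp y)" unfolding block_eq by simp
  then show ?thesis by metis
qed

lemma bij_swp: "bij swp"
  by (rule o_bij[of swp]) (auto simp: fun_eq_iff)

lemma card_block_Collect:
  "card {w. ix w = ix z \<and> P w} = of_bool (P z) + (if swp z = z then 0 else of_bool (P (swp z)))"
proof -
  have "{w. ix w = ix z \<and> P w} = {w. (w = z \<or> w = swp z) \<and> P w}" by (simp add: ix_eq_iff)
  also have "\<dots> = (if P z then {z} else {}) \<union> (if P (swp z) then {swp z} else {})" by auto
  finally show ?thesis by auto
qed

text \<open>Consider the array of relations between the points of two sets and let \<open>k\<close>
  be the relation of \<open>y\<close> and \<open>z\<close>. If the diagonally opposite entry were
  not \<open>k\<close>, equality of row counts would make \<open>k\<close> occur more often at one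
  of the two remaining places than at the other, and equality of column counts would say the
  reverse.\<close>

lemma rel_of_swp: "rel_of (swp y) (swp z) = rel_of y z"
proof -
  let ?k = "rel_of y z"
  have "card {w. ix w = ix z \<and> rel_of y w = ?k} = card {w. ix w = ix z \<and> rel_of (swp y) w = ?k}"
    by (rule row_card) auto
  moreover have "card {w. ix w = ix y \<and> rel_of w z = ?k} = card {w. ix w = ix y \<and> rel_of w (swp z) = ?k}"
    by (rule col_card) auto
  ultimately show ?thesis unfolding card_block_Collect of_bool_def by (auto split: if_splits)
qed

lemma rel_of_swp_left: "rel_of (swp y) z = rel_of y (swp z)"
  using rel_of_swp[of y "swp z"] by simp

section \<open>Split pairs, bad pairs and the equivalence relation\<close>

definition split_rel :: "nat rel" where
  "split_rel = {(a, b). a \<in> A_set R d 2 \<and> b \<in> A_set R d 2 \<and> (\<exists>j\<le>d. inum R a j b = 1)}"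

text \<open>At the pair \<open>(x, z)\<close> the number \<open>inum R (ix y) j (ix z)\<close>
  counts which of \<open>y\<close> and its partner stand in relation \<open>j\<close> to
  \<open>z\<close>. It is 1 for some \<open>j\<close> exactly if their relations to \<open>z\<close>
  differ.\<close>

lemma split_rel_iff:
  "(ix y, ix z) \<in> split_rel \<longleftrightarrow> val (ix y) = 2 \<and> val (ix z) = 2 \<and> rel_of y z \<noteq> rel_of (swp y) z"
proof -
  have "(\<exists>j\<le>d. inum R (ix y) j (ix z) = 1) \<longleftrightarrow> rel_of y z \<noteq> rel_of (swp y) z" if "val (ix y) = 2"
  proof -
    have "swp y \<noteq> y" using that swp_fixed_iff by auto
    then have *: "inum R (ix y) j (ix z) = of_bool (rel_of y z = j) + of_bool (rel_of (swp y) z = j)" if "j \<le> d" for j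
      using that inum_rel_of[of "ix y" j x z] card_block_Collect[of y "\<lambda>l. rel_of l z = j"] by simp
    show ?thesis
    proof
      assume "\<exists>j\<le>d. inum R (ix y) j (ix z) = 1"
      then show "rel_of y z \<noteq> rel_of (swp y) z" using * by (auto simp: of_bool_def split: if_splits)
    next
      assume "rel_of y z \<noteq> rel_of (swp y) z"
      then show "\<exists>j\<le>d. inum R (ix y) j (ix z) = 1" using *[of "rel_of y z"] by (intro exI[of _ "rel_of y z"]) auto
    qed
  qed
  then show ?thesis by (auto simp: split_rel_def A_set_def)
qed

text \<open>A relation \<open>c\<close> in the product comes from a triangle somewhere in the
  scheme. Its third vertex \<open>l\<close> sees the other two in the relations \<open>ix y\<close>
  and \<open>ix z\<close>, so constancy of \<open>inum R (ix y) c (ix z)\<close> moves the triangle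
  to the vertex \<open>x\<close>, where the point over \<open>ix y\<close> can only be
  \<open>y\<close> or its partner.\<close>

lemma cprod_eq: "cprod R d (cv (ix y)) (ix z) = {rel_of y z, rel_of (swp y) z}"
proof -
  have "c \<in> cprod R d (cv (ix y)) (ix z) \<longleftrightarrow> c = rel_of y z \<or> c = rel_of (swp y) z" for c
  proof
    assume c: "c \<in> cprod R d (cv (ix y)) (ix z)"
    then have cd: "c \<le> d" by (simp add: cprod_def)
    then obtain m n where mn: "rel_of m n = c" using rel_of_ex by blast
    with c have "0 < card {l. rel_of m l = cv (ix y) \<and> rel_of l n = ix z}"
      using inum_rel_of[of "cv (ix y)" "ix z" m n] cv[of "ix y"] by (simp add: cprod_def)
    then obtain l where l: "rel_of l m = ix y" "rel_of l n = ix z"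
      by (auto simp: card_gt_0_iff rel_of_eq_cv_iff)
    then have "{w. rel_of l w = ix y \<and> rel_of w n = c} \<noteq> {}" using mn by auto
    then have "inum R (ix y) c (ix z) \<noteq> 0"
      using inum_rel_of[of "ix y" c l n] cd l by simp
    then obtain w where "ix w = ix y" "rel_of w z = c"
      using inum_rel_of[of "ix y" c x z] cd by auto
    then show "c = rel_of y z \<or> c = rel_of (swp y) z" by (auto simp: ix_eq_iff)
  next
    have *: "rel_of w z \<in> cprod R d (cv (ix y)) (ix z)" if "ix w = ix y" for w
    proof -
      have "x \<in> {l. rel_of w l = cv (ix y) \<and> ix z = rel_of l z}" using that by (simp add: rel_of_eq_cv_iff)
      then show ?thesis
        using inum_rel_of[of "cv (ix y)" "ix z" w z] cv[of "ix y"]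
        by (auto simp: cprod_def card_gt_0_iff)
    qed
    assume "c = rel_of y z \<or> c = rel_of (swp y) z"
    then show "c \<in> cprod R d (cv (ix y)) (ix z)" using * by auto
  qed
  then show ?thesis by auto
qed

lemma A2_ix: "a \<in> A_set R d 2 \<Longrightarrow> \<exists>y. ix y = a \<and> val (ix y) = 2"
  using ix_ex by (auto simp: A_set_def)

lemma card_cprod:
  assumes "a \<in> A_set R d 2" "b \<in> A_set R d 2"
  shows "card (cprod R d (cv a) b) = (if (a, b) \<in> split_rel then 2 else 1)"
proof -
  obtain y z where yz: "ix y = a" "ix z = b" "val (ix y) = 2" "val (ix z) = 2"
    using A2_ix assms by metis
  then show ?thesis using cprod_eq[of y z] split_rel_iff[of y z] by auto
qed

text \<open>The partner can be moved from the first argument of \<open>rel_of\<close> to the second,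
  and passing to converse relations exchanges the arguments.\<close>

lemma sym_split_rel: "sym split_rel"
proof (rule symI)
  fix a b assume ab: "(a, b) \<in> split_rel"
  then obtain y z where yz: "ix y = a" "ix z = b" "val (ix y) = 2" "val (ix z) = 2"
    using A2_ix unfolding split_rel_def by blast
  with ab have "rel_of y z \<noteq> rel_of y (swp z)" using split_rel_iff[of y z] by (simp add: rel_of_swp_left)
  then have "rel_of z y \<noteq> rel_of (swp z) y" using rel_of_eq_cv_iff[of "rel_of y z" "swp z" y] rel_of_swap[of z y] by auto
  then show "(b, a) \<in> split_rel" using split_rel_iff[of z y] yz by auto
qed

abbreviation sim :: "nat rel" where "sim \<equiv> sim_rel R d"

text \<open>The chain in a bad pair is a path of at least two split steps, and the product of size 1
  says that its ends are not split themselves. The product of size 2 supplies the paths of length 1,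
  and length 0 adds nothing because \<open>split_rel\<close> is reflexive on
  \<open>A_set R d 2\<close>.\<close>

lemma sim_eq: "sim = {(a, b). a \<in> A_set R d 2 \<and> b \<in> A_set R d 2 \<and> (a, b) \<in> split_rel\<^sup>*}"
proof -
  have "card (cprod R d (cv a) b) = 2 \<or> bad_pair R d a b \<longleftrightarrow> (a, b) \<in> split_rel\<^sup>*" (is "?l \<longleftrightarrow> ?r")
    if ab: "a \<in> A_set R d 2" "b \<in> A_set R d 2" for a b
  proof
    assume ?l
    then show ?r
    proof
      assume "card (cprod R d (cv a) b) = 2"
      then show ?r using card_cprod[OF ab] by (auto split: if_splits)
    next
      assume "bad_pair R d a b"
      then obtain m i j l where bp:
        "\<forall>b\<le>m. i b \<le> d \<and> j b \<le> d \<and> l b \<le> d \<and> val (i b) = 2 \<and> val (l b) = 2 \<and> inum R (i b) (j b) (l b) = 1"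
        "i 0 = a" "l m = b" "\<forall>c<m. l c = i (Suc c)"
        unfolding bad_pair_def by blast
      then have st: "(i c, l c) \<in> split_rel" if "c \<le> m" for c
        using that unfolding split_rel_def A_set_def by blast
      have "(a, l c) \<in> split_rel\<^sup>*" if "c \<le> m" for c
        using that
      proof (induction c)
        case 0
        then show ?case using st[of 0] bp by auto
      next
        case (Suc c)
        then have "(l c, l (Suc c)) \<in> split_rel" using st[of "Suc c"] bp(4) by auto
        with Suc show ?case by (simp add: rtrancl.rtrancl_into_rtrancl)
      qed
      then show ?r using bp by auto
    qed
  next
    assume ?r
    then obtain m where m: "(a, b) \<in> split_rel ^^ m" by (auto simp: rtrancl_power)
    show ?l
    proof (cases "(a, b) \<in> split_rel")
      case True
      then show ?thesis using card_cprod[OF ab] by simp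
    next
      case False
      \<comment> \<open>A point is related to itself by the diagonal relation, and to its distinct
        partner by another one.\<close>
      have refl: "(a, a) \<in> split_rel"
      proof -
        obtain y where y: "ix y = a" "val (ix y) = 2" using A2_ix ab by blast
        then have "swp y \<noteq> y" using swp_fixed_iff by auto
        then have "rel_of y y \<noteq> rel_of (swp y) y" by (metis rel_of_0_iff)
        then show ?thesis using y split_rel_iff[of y y] by auto
      qed
      have "m \<noteq> 0" using m refl False by (cases m) auto
      moreover have "m \<noteq> 1" using m False by auto
      ultimately have m2: "m - 1 \<ge> 1" by linarith
      from m obtain f where f: "f 0 = a" "f m = b" "\<And>c. c < m \<Longrightarrow> (f c, f (Suc c)) \<in> split_rel"
        by (auto simp: relpow_fun_conv)
      have "\<exists>k. \<forall>c<m. k c \<le> d \<and> inum R (f c) (k c) (f (Suc c)) = 1"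
        using f(3) unfolding split_rel_def by (intro choice) blast
      then obtain k where k: "\<forall>c<m. k c \<le> d \<and> inum R (f c) (k c) (f (Suc c)) = 1" by blast
      \<comment> \<open>The data of a bad pair are indexed from 0 up to and including the bound. A
        path of \<open>m\<close> steps therefore has bound \<open>m - 1\<close>, which is at least 1
        because \<open>m\<close> is neither 0 nor 1.\<close>
      have "bad_pair R d a b"
        unfolding bad_pair_def
      proof (rule exI[of _ "m - 1"], rule exI[of _ f], rule exI[of _ k], rule exI[of _ "f \<circ> Suc"],
          intro conjI)
        show "\<forall>c\<le>m - 1. f c \<le> d \<and> k c \<le> d \<and> (f \<circ> Suc) c \<le> d \<and> val (f c) = 2 \<and> val ((f \<circ> Suc) c) = 2
            \<and> inum R (f c) (k c) ((f \<circ> Suc) c) = 1"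
        proof (intro allI impI)
          fix c assume "c \<le> m - 1"
          then have "c < m" using m2 by linarith
          with f(3)[OF this] k show "f c \<le> d \<and> k c \<le> d \<and> (f \<circ> Suc) c \<le> d \<and> val (f c) = 2
            \<and> val ((f \<circ> Suc) c) = 2 \<and> inum R (f c) (k c) ((f \<circ> Suc) c) = 1"
            by (auto simp: split_rel_def A_set_def)
        qed
        show "card (cprod R d (cv a) b) = 1" using card_cprod[OF ab] False by simp
      qed (use m2 f in auto)
      then show ?thesis ..
    qed
  qed
  then show ?thesis unfolding sim_rel_def by auto
qed

lemma equiv_sim: "equiv (A_set R d 2) sim"
proof (rule equivI)
  show "sim \<subseteq> A_set R d 2 \<times> A_set R d 2" unfolding sim_eq by auto
  show "refl_on (A_set R d 2) sim" unfolding sim_eq by (auto simp: refl_on_def)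
  show "sym sim" using sym_rtrancl[OF sym_split_rel] unfolding sim_eq sym_def by auto
  show "trans sim" unfolding sim_eq trans_def by auto
qed

lemma simD: "(a, b) \<in> sim \<Longrightarrow> a \<le> d \<and> b \<le> d \<and> val a = 2 \<and> val b = 2"
  unfolding sim_eq A_set_def by auto

lemma sim_refl: "a \<le> d \<Longrightarrow> val a = 2 \<Longrightarrow> (a, a) \<in> sim"
  unfolding sim_eq A_set_def by auto

lemma sim_trans: "(a, b) \<in> sim \<Longrightarrow> (b, c) \<in> sim \<Longrightarrow> (a, c) \<in> sim"
  using equiv_sim unfolding equiv_def trans_def by blast

lemma swp_fixed_if_not_sim: "ix z = ix y \<Longrightarrow> (ix y, ix z) \<notin> sim \<Longrightarrow> swp y = y"
  using sim_refl[of "ix y"] val_cases[of "ix y"] swp_fixed_iff by auto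

section \<open>The Terwilliger algebra of a quasi-thin scheme\<close>

text \<open>The second condition moves the row only. By the first, it also allows the column to be
  moved, so a block off \<open>sim\<close> is constant.\<close>

definition swap_alg :: "('x, 'a::field) xmat set" where
  "swap_alg = {M. (\<forall>y z. M (swp y) (swp z) = M y z) \<and> (\<forall>y z. (ix y, ix z) \<notin> sim \<longrightarrow> M (swp y) z = M y z)}"

lemma swap_algI: "(\<And>y z. M (swp y) (swp z) = M y z) \<Longrightarrow> (\<And>y z. (ix y, ix z) \<notin> sim \<Longrightarrow> M (swp y) z = M y z)
    \<Longrightarrow> M \<in> swap_alg"
  by (simp add: swap_alg_def)

lemma swap_alg_swp: "M \<in> swap_alg \<Longrightarrow> M (swp y) (swp z) = M y z"
  by (simp add: swap_alg_def)

lemma swap_alg_swp_left: "M \<in> swap_alg \<Longrightarrow> M (swp y) z = M y (swp z)"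
  using swap_alg_swp[of M y "swp z"] by simp

lemma swap_alg_not_sim: "M \<in> swap_alg \<Longrightarrow> (ix y, ix z) \<notin> sim \<Longrightarrow> M (swp y) z = M y z"
  by (simp add: swap_alg_def)

lemma sum_swp: "(\<Sum>w\<in>UNIV. f (swp w)) = (\<Sum>w\<in>UNIV. f w)"
  using sum.reindex_bij_betw[OF bij_swp] by simp

text \<open>Transitivity of \<open>sim\<close> is the point: if \<open>y\<close> and
  \<open>z\<close> are not similar, no \<open>w\<close> is similar to both. For \<open>w\<close>
  similar to \<open>y\<close>, moving the row is absorbed by passing to the partner of
  \<open>w\<close>, which the second factor does not notice; for any other \<open>w\<close> the
  first factor does not notice the move.\<close>

lemma mmult_in_swap_alg:
  assumes M: "M \<in> swap_alg" and N: "N \<in> swap_alg"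
  shows "mmult M N \<in> swap_alg"
proof (rule swap_algI)
  fix y z
  have "mmult M N (swp y) (swp z) = (\<Sum>w\<in>UNIV. M (swp y) (swp w) * N (swp w) (swp z))"
    unfolding mmult_def by (rule sum_swp[symmetric])
  then show "mmult M N (swp y) (swp z) = mmult M N y z" by (simp add: mmult_def swap_alg_swp M N)
next
  fix y z assume ns: "(ix y, ix z) \<notin> sim"
  let ?t = "\<lambda>w. if (ix y, ix w) \<in> sim then swp w else w"
  have "bij ?t" by (rule o_bij[of ?t]) (auto simp: fun_eq_iff)
  then have "mmult M N (swp y) z = (\<Sum>w\<in>UNIV. M (swp y) (?t w) * N (?t w) z)"
    unfolding mmult_def by (rule sum.reindex_bij_betw[symmetric])
  also have "\<dots> = (\<Sum>w\<in>UNIV. M y w * N w z)"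
  proof (rule sum.cong[OF refl])
    fix w
    show "M (swp y) (?t w) * N (?t w) z = M y w * N w z"
    proof (cases "(ix y, ix w) \<in> sim")
      case True
      then have "(ix w, ix z) \<notin> sim" using ns sim_trans by blast
      then show ?thesis using True by (simp add: swap_alg_swp[OF M] swap_alg_not_sim[OF N])
    qed (simp add: swap_alg_not_sim[OF M])
  qed
  finally show "mmult M N (swp y) z = mmult M N y z" by (simp add: mmult_def)
qed

text \<open>For an adjacency matrix, a relation can tell a point from its partner only between
  two-point sets that form a split pair, and such pairs are similar.\<close>

lemma terwilliger_subset_swap_alg: "terwilliger R d x \<subseteq> (swap_alg :: ('x, 'a::field) xmat set)"
proof
  fix M :: "('x, 'a) xmat" assume "M \<in> terwilliger R d x"
  then show "M \<in> swap_alg"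
  proof induction
    case (gen_A k)
    have "rel_of (swp y) z = rel_of y z" if "(ix y, ix z) \<notin> sim" for y z
    proof -
      consider "val (ix y) = 1" | "val (ix z) = 1" | "val (ix y) = 2" "val (ix z) = 2"
        using val_cases[of "ix y"] val_cases[of "ix z"] by auto
      then show ?thesis
      proof cases
        case 1
        then show ?thesis using swp_fixed_iff[of y] by simp
      next
        case 2
        then show ?thesis using swp_fixed_iff[of z] rel_of_swp_left[of y z] by simp
      next
        case 3
        then have "(ix y, ix z) \<notin> split_rel" using that unfolding sim_eq A_set_def by auto
        then show ?thesis using 3 split_rel_iff[of y z] by simp
      qed
    qed
    then show ?case using gen_A by (intro swap_algI) (auto simp: adj_mat_def in_R_iff rel_of_swp)
  next
    case (gen_E a)
    show ?case
    proof (rule swap_algI)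
      fix y z
      have "swp y = swp z \<longleftrightarrow> y = z" by (metis swp_swp)
      then show "dual_idem R x a (swp y) (swp z) = (dual_idem R x a y z :: 'a)"
        using gen_E by (auto simp: dual_idem_def in_R_iff)
    next
      fix y z assume "(ix y, ix z) \<notin> sim"
      then have "ix y = ix z \<Longrightarrow> swp y = y" using swp_fixed_if_not_sim[of z y] by auto
      then show "dual_idem R x a (swp y) z = (dual_idem R x a y z :: 'a)"
        by (metis (no_types, lifting) dual_idem_def ix_swp)
    qed
  next
    case (add A B)
    then show ?case by (intro swap_algI) (auto simp: swap_alg_swp swap_alg_not_sim)
  next
    case (smult A c)
    then show ?case by (intro swap_algI) (auto simp: msmult_def swap_alg_swp swap_alg_not_sim)
  next
    case (mult A B)
    then show ?case by (intro mmult_in_swap_alg)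
  qed
qed

section \<open>Orientation of the two-point sets and a spanning set of the algebra\<close>

definition rep_pt :: "nat \<Rightarrow> 'x" where "rep_pt a = (SOME y. ix y = a)"

definition oriented :: "'x \<Rightarrow> bool" where "oriented y \<longleftrightarrow> y = rep_pt (ix y)"

lemma ix_rep_pt [simp]: "a \<le> d \<Longrightarrow> ix (rep_pt a) = a"
  unfolding rep_pt_def using ix_ex by (rule someI_ex)

lemma oriented_rep_pt [simp]: "a \<le> d \<Longrightarrow> oriented (rep_pt a)"
  by (simp add: oriented_def)

lemma oriented_cases: "(oriented y \<and> y = rep_pt (ix y)) \<or> (\<not> oriented y \<and> y = swp (rep_pt (ix y)))"
  using ix_eq_iff[of y "rep_pt (ix y)"] by (auto simp: oriented_def)

lemma oriented_swp: "val (ix y) = 2 \<Longrightarrow> oriented (swp y) \<longleftrightarrow> \<not> oriented y"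
proof -
  assume "val (ix y) = 2"
  then have "swp y \<noteq> y" using swp_fixed_iff by auto
  then show ?thesis unfolding oriented_def ix_swp using oriented_cases[of y] by (metis swp_swp)
qed

lemma eq_iff_oriented: "y = z \<longleftrightarrow> ix y = ix z \<and> oriented y = oriented z"
  using oriented_cases[of y] oriented_cases[of z] by metis

lemma block_sum:
  assumes "b \<le> d"
  shows "(\<Sum>w | ix w = b. f w) = (if val b = 1 then f (rep_pt b) else f (rep_pt b) + f (swp (rep_pt b)))"
proof -
  have *: "{w. ix w = b} = {rep_pt b, swp (rep_pt b)}" using block_eq[of "rep_pt b"] assms by simp
  show ?thesis using swp_fixed_iff[of "rep_pt b"] assms unfolding * by auto
qed

lemma sum_blocks: "(\<Sum>w\<in>UNIV. f w) = (\<Sum>b\<le>d. \<Sum>w | ix w = b. f w)"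
  using sum.group[of UNIV "{..d}" ix f] by (simp add: image_subset_iff)

lemma dual_idem_mmult:
  assumes "a \<le> d"
  shows "mmult (dual_idem R x a) M = (\<lambda>y z. if ix y = a then M y z else 0)"
    and "mmult M (dual_idem R x a) = (\<lambda>y z. if ix z = a then M y z else 0)"
proof -
  have "mmult (dual_idem R x a) M y z = (\<Sum>w\<in>UNIV. if w = y then (if ix y = a then M y z else 0) else 0)" for y z
    unfolding mmult_def by (intro sum.cong) (auto simp: dual_idem_def in_R_iff assms)
  then show "mmult (dual_idem R x a) M = (\<lambda>y z. if ix y = a then M y z else 0)" by (auto simp: fun_eq_iff)
  have "mmult M (dual_idem R x a) y z = (\<Sum>w\<in>UNIV. if w = z then (if ix z = a then M y z else 0) else 0)" for y z
    unfolding mmult_def by (intro sum.cong) (auto simp: dual_idem_def in_R_iff assms)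
  then show "mmult M (dual_idem R x a) = (\<lambda>y z. if ix z = a then M y z else 0)" by (auto simp: fun_eq_iff)
qed

lemma terwilliger_corner:
  assumes "a \<le> d" "b \<le> d" "M \<in> terwilliger R d x"
  shows "(\<lambda>y z. if ix y = a \<and> ix z = b then M y z else 0) \<in> terwilliger R d x"
proof -
  have "mmult (dual_idem R x a) (mmult M (dual_idem R x b)) \<in> terwilliger R d x"
    using assms by (intro terwilliger.mult terwilliger.gen_E)
  moreover have "mmult (dual_idem R x a) (mmult M (dual_idem R x b))
      = (\<lambda>y z. if ix y = a \<and> ix z = b then M y z else 0)"
    using assms by (auto simp: dual_idem_mmult fun_eq_iff)
  ultimately show ?thesis by simp
qed

lemma zero_in_terwilliger: "(0 :: ('x, 'a::field) xmat) \<in> terwilliger R d x"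
  using terwilliger.smult[OF terwilliger.gen_E[of 0 d R x], of 0] by (simp add: msmult_def zero_fun_def)

lemma terwilliger_sum:
  "(\<And>i. i \<in> S \<Longrightarrow> f i \<in> terwilliger R d x) \<Longrightarrow> (\<Sum>i\<in>S. f i) \<in> (terwilliger R d x :: ('x, 'a::field) xmat set)"
  by (rule sum_closed[OF zero_in_terwilliger terwilliger.add])

definition Jblk :: "nat \<Rightarrow> nat \<Rightarrow> ('x, 'a::field) xmat" where
  "Jblk a b = (\<lambda>y z. if ix y = a \<and> ix z = b then 1 else 0)"

text \<open>Between two-point sets this is one of the two matchings. Fixing an orientation once for
  all sets makes these matchings multiply like matrix units.\<close>

definition Pblk :: "nat \<Rightarrow> nat \<Rightarrow> ('x, 'a::field) xmat" where
  "Pblk a b = (\<lambda>y z. if ix y = a \<and> ix z = b \<and> oriented y = oriented z then 1 else 0)"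

lemma Jblk_in: assumes "a \<le> d" "b \<le> d" shows "Jblk a b \<in> (terwilliger R d x :: ('x, 'a::field) xmat set)"
proof -
  have "(\<Sum>k\<le>d. adj_mat R k) \<in> (terwilliger R d x :: ('x, 'a) xmat set)"
    by (intro terwilliger_sum terwilliger.gen_A) simp
  moreover have "(\<Sum>k\<le>d. adj_mat R k) = (\<lambda>y z. 1 :: 'a)"
  proof (intro ext)
    fix y z
    have "(\<Sum>k\<le>d. adj_mat R k) y z = (\<Sum>k\<le>d. if k = rel_of y z then 1 else 0 :: 'a)"
      unfolding sum_fun_apply by (intro sum.cong) (auto simp: adj_mat_def in_R_iff)
    then show "(\<Sum>k\<le>d. adj_mat R k) y z = (1 :: 'a)" by simp
  qed
  ultimately show ?thesis using terwilliger_corner[OF assms] unfolding Jblk_def by simp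
qed

lemma Pblk_mult: assumes "b \<le> d" "val b = 2" shows "mmult (Pblk a b) (Pblk b c) = Pblk a c"
proof (intro ext)
  fix y z
  have "mmult (Pblk a b) (Pblk b c) y z
      = (\<Sum>w\<in>UNIV. if ix w = b \<and> oriented w = oriented y then Pblk a c y z else 0)"
    unfolding mmult_def by (intro sum.cong) (auto simp: Pblk_def)
  also have "\<dots> = (\<Sum>w\<in>UNIV. if w = (if oriented y then rep_pt b else swp (rep_pt b)) then Pblk a c y z else 0)"
  proof (intro sum.cong[OF refl])
    fix w
    have "ix w = b \<and> oriented w = oriented y \<longleftrightarrow> w = (if oriented y then rep_pt b else swp (rep_pt b))"
      unfolding eq_iff_oriented[of w "if oriented y then rep_pt b else swp (rep_pt b)"]
      using assms oriented_swp[of "rep_pt b"] by auto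
    then show "(if ix w = b \<and> oriented w = oriented y then Pblk a c y z else 0)
      = (if w = (if oriented y then rep_pt b else swp (rep_pt b)) then Pblk a c y z else 0)" by auto
  qed
  also have "\<dots> = Pblk a c y z" by simp
  finally show "mmult (Pblk a b) (Pblk b c) y z = Pblk a c y z" .
qed

text \<open>Induction along a path of split pairs. The path starts with a dual idempotent, each
  split step contributes a corner of an adjacency matrix, and \<open>Pblk_mult\<close> composes
  them.\<close>

lemma Pblk_in:
  assumes "(a, b) \<in> sim" shows "Pblk a b \<in> (terwilliger R d x :: ('x, 'a::field) xmat set)"
proof -
  have a: "a \<le> d" "val a = 2" and ab: "(a, b) \<in> split_rel\<^sup>*" using assms unfolding sim_eq A_set_def by auto
  from ab show ?thesis
  proof (induction rule: rtrancl_induct)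
    case base
    have "Pblk a a = (dual_idem R x a :: ('x, 'a) xmat)"
      using a by (auto simp: Pblk_def dual_idem_def fun_eq_iff in_R_iff eq_iff_oriented)
    then show ?case using terwilliger.gen_E[OF a(1)] by simp
  next
    case (step b c)
    have b: "b \<le> d" "val b = 2" and c: "c \<le> d" "val c = 2" using step unfolding split_rel_def A_set_def by auto
    \<comment> \<open>Taking the relation between the two base points selects the matching that
      preserves orientation and not the opposite one.\<close>
    let ?k = "rel_of (rep_pt b) (rep_pt c)"
    have ne: "rel_of (swp (rep_pt b)) (rep_pt c) \<noteq> ?k" using split_rel_iff[of "rep_pt b" "rep_pt c"] step b c by auto
    have "rel_of y z = ?k \<longleftrightarrow> oriented y = oriented z" if "ix y = b" "ix z = c" for y z
      using oriented_cases[of y] oriented_cases[of z] that ne rel_of_swp[of "rep_pt b" "rep_pt c"] rel_of_swp_left[of "rep_pt b" "rep_pt c"]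
      by auto
    then have e: "(\<lambda>y z. if ix y = b \<and> ix z = c then adj_mat R ?k y z else 0) = (Pblk b c :: ('x, 'a) xmat)"
      by (auto simp: fun_eq_iff Pblk_def adj_mat_def in_R_iff)
    have "Pblk b c \<in> (terwilliger R d x :: ('x, 'a) xmat set)"
      unfolding e[symmetric] by (rule terwilliger_corner[OF b(1) c(1) terwilliger.gen_A[OF rel_of_le]])
    from terwilliger.mult[OF step.IH this] show ?case unfolding Pblk_mult[OF b] .
  qed
qed

text \<open>A block of a matrix commuting with the involution has one value on pairs of opposite
  orientation and one on pairs of equal orientation. The former is the coefficient of the all-ones
  block, the excess of the latter that of the matching; off \<open>sim\<close> there is no
  excess.\<close>

lemma terwilliger_eq: "terwilliger R d x = (swap_alg :: ('x, 'a::field) xmat set)"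
proof (rule subset_antisym[OF terwilliger_subset_swap_alg], rule subsetI)
  fix M :: "('x, 'a) xmat" assume M: "M \<in> swap_alg"
  define B where "B a b = (if (a, b) \<in> sim
      then msmult (M (rep_pt a) (swp (rep_pt b))) (Jblk a b) + msmult (M (rep_pt a) (rep_pt b) - M (rep_pt a) (swp (rep_pt b))) (Pblk a b)
      else msmult (M (rep_pt a) (rep_pt b)) (Jblk a b))" for a b
  have "(\<Sum>a\<le>d. \<Sum>b\<le>d. B a b) \<in> terwilliger R d x"
    unfolding B_def
    by (intro terwilliger_sum) (auto intro!: terwilliger.add terwilliger.smult Jblk_in Pblk_in)
  also have "(\<Sum>a\<le>d. \<Sum>b\<le>d. B a b) = M"
  proof (intro ext)
    fix y z
    have Bz: "B a b y z = 0" if "\<not> (a = ix y \<and> b = ix z)" for a b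
      using that by (auto simp: B_def Jblk_def Pblk_def msmult_def)
    have Bm: "B (ix y) (ix z) y z = M y z"
    proof (cases "(ix y, ix z) \<in> sim")
      case True
      then show ?thesis
        using oriented_cases[of y] oriented_cases[of z] swap_alg_swp[OF M, of "rep_pt (ix y)" "rep_pt (ix z)"]
          swap_alg_swp_left[OF M, of "rep_pt (ix y)" "rep_pt (ix z)"]
        by (auto simp: B_def Jblk_def Pblk_def msmult_def)
    next
      case False
      then have "M (swp (rep_pt (ix y))) (rep_pt (ix z)) = M (rep_pt (ix y)) (rep_pt (ix z))"
        by (intro swap_alg_not_sim[OF M]) auto
      then have "M y z = M (rep_pt (ix y)) (rep_pt (ix z))"
        using oriented_cases[of y] oriented_cases[of z] swap_alg_swp[OF M, of "rep_pt (ix y)" "rep_pt (ix z)"]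
          swap_alg_swp_left[OF M, of "rep_pt (ix y)" "rep_pt (ix z)"] by metis
      then show ?thesis using False by (simp add: B_def Jblk_def msmult_def)
    qed
    have "(\<Sum>a\<le>d. \<Sum>b\<le>d. B a b) y z = (\<Sum>a\<le>d. \<Sum>b\<le>d. B a b y z)"
      by (simp add: sum_fun_apply)
    also have "\<dots> = (\<Sum>a\<le>d. if a = ix y then M y z else 0)"
    proof (intro sum.cong[OF refl])
      fix a
      have "(\<Sum>b\<le>d. B a b y z) = (\<Sum>b\<le>d. if b = ix z then (if a = ix y then M y z else 0) else 0)"
        using Bz Bm by (intro sum.cong) auto
      then show "(\<Sum>b\<le>d. B a b y z) = (if a = ix y then M y z else 0)" by simp
    qed
    also have "\<dots> = M y z" by simp
    finally show "(\<Sum>a\<le>d. \<Sum>b\<le>d. B a b) y z = M y z" .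
  qed
  finally show "M \<in> terwilliger R d x" .
qed

lemma thin_terwilliger: "thin R d \<Longrightarrow> terwilliger R d x = (UNIV :: ('x, 'a::field) xmat set)"
proof -
  assume "thin R d"
  then have "swp y = y" for y by (simp add: swp_fixed_iff thin_def)
  then show ?thesis unfolding terwilliger_eq by (auto intro: swap_algI)
qed

lemma mone_in_swap_alg: "mone \<in> swap_alg"
proof (rule swap_algI)
  fix y z
  have "swp y = swp z \<longleftrightarrow> y = z" by (metis swp_swp)
  then show "mone (swp y) (swp z) = (mone y z :: 'a)" by (simp add: mone_def)
next
  fix y z assume "(ix y, ix z) \<notin> sim"
  then have "ix y = ix z \<Longrightarrow> swp y = y" using swp_fixed_if_not_sim[of z y] by auto
  then show "mone (swp y) z = (mone y z :: 'a)" by (metis mone_def ix_swp)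
qed

end

section \<open>The actions on invariant and on alternating vectors\<close>

text \<open>Q0 indexes the sets xR_a on which the action on invariant vectors is recorded: all of them if 2 is
  invertible, and otherwise only the one-point sets, where the compression is still multiplicative.\<close>

locale qt_scheme_field = qt_scheme R d x
  for R :: "nat \<Rightarrow> ('x::finite \<times> 'x) set" and d :: nat and x :: 'x +
  fixes F :: "'a::field itself" and Q0 :: "nat set"
  assumes Q0: "(2::'a) \<noteq> 0 \<and> Q0 = {..d} \<or> (2::'a) = 0 \<and> Q0 = A_set R d 1"
begin

text \<open>The value at \<open>rep_pt a\<close> of \<open>M\<close> applied to the indicator vector
  of the set with index \<open>b\<close>.\<close>

definition sym_part :: "('x, 'a) xmat \<Rightarrow> nat \<Rightarrow> nat \<Rightarrow> 'a" where
  "sym_part M a b = (\<Sum>z | ix z = b. M (rep_pt a) z)"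

text \<open>The value at \<open>rep_pt a\<close> of \<open>M\<close> applied to the vector that is 1
  at \<open>rep_pt b\<close> and -1 at its partner; for a one-point set the two terms
  cancel.\<close>

definition alt_part :: "('x, 'a) xmat \<Rightarrow> nat \<Rightarrow> nat \<Rightarrow> 'a" where
  "alt_part M a b = M (rep_pt a) (rep_pt b) - M (rep_pt a) (swp (rep_pt b))"

lemma Q0_le: "a \<in> Q0 \<Longrightarrow> a \<le> d"
  using Q0 by (auto simp: A_set_def)

lemma val_0: "val 0 = 1"
  using val_eq[of 0 x] by (simp add: rel_of_0_iff)

text \<open>The diagonal relation has valency 1, so one-point sets exist. This keeps the matrix size
  of the component \<open>None\<close> positive in characteristic 2.\<close>

lemma Q0_nonempty: "0 \<in> Q0"
  using Q0 val_0 by (auto simp: A_set_def)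

text \<open>The property shared by the two choices of \<open>Q0\<close>: a constant block
  contributes its value times the valency to \<open>sym_part\<close>, and surjectivity has to divide
  by that valency.\<close>

lemma Q0_val: "a \<in> Q0 \<Longrightarrow> of_nat (val a) \<noteq> (0::'a)"
  using Q0 val_cases[of a] by (auto simp: A_set_def)

text \<open>Moving the row to its partner only permutes the columns of the block, so the row sum
  stays the same.\<close>

lemma sym_part_row:
  assumes N: "N \<in> swap_alg" shows "(\<Sum>z | ix z = c. N w z) = sym_part N (ix w) c"
proof -
  have "bij_betw swp {z. ix z = c} {z. ix z = c}"
    by (rule bij_betw_byWitness[of _ swp]) auto
  then have "(\<Sum>z | ix z = c. N (rep_pt (ix w)) (swp z)) = (\<Sum>z | ix z = c. N (rep_pt (ix w)) z)"
    by (rule sum.reindex_bij_betw)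
  moreover have "N (swp (rep_pt (ix w))) z = N (rep_pt (ix w)) (swp z)" for z by (rule swap_alg_swp_left[OF N])
  ultimately have "(\<Sum>z | ix z = c. N (swp (rep_pt (ix w))) z) = sym_part N (ix w) c"
    by (simp add: sym_part_def)
  then show ?thesis using oriented_cases[of w] by (metis sym_part_def)
qed

lemma sym_part_mmult_all:
  assumes M: "M \<in> swap_alg" and N: "N \<in> swap_alg"
  shows "sym_part (mmult M N) a c = (\<Sum>b\<le>d. sym_part M a b * sym_part N b c)"
proof -
  have "sym_part (mmult M N) a c = (\<Sum>w\<in>UNIV. \<Sum>z | ix z = c. M (rep_pt a) w * N w z)"
    unfolding sym_part_def mmult_def by (rule sum.swap)
  also have "\<dots> = (\<Sum>w\<in>UNIV. M (rep_pt a) w * sym_part N (ix w) c)"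
    by (simp add: sum_distrib_left[symmetric] sym_part_row[OF N])
  also have "\<dots> = (\<Sum>b\<le>d. \<Sum>w | ix w = b. M (rep_pt a) w * sym_part N (ix w) c)" by (rule sum_blocks)
  also have "\<dots> = (\<Sum>b\<le>d. sym_part M a b * sym_part N b c)"
    by (intro sum.cong) (auto simp: sym_part_def sum_distrib_right)
  finally show ?thesis .
qed

text \<open>In characteristic 2 the omitted terms are zero: the row of a one-point set takes equal
  values at both points of a two-point set, and these add up to 0.\<close>

lemma sym_part_mmult:
  assumes M: "M \<in> swap_alg" and N: "N \<in> swap_alg" and a: "a \<in> Q0"
  shows "sym_part (mmult M N) a c = (\<Sum>b\<in>Q0. sym_part M a b * sym_part N b c)"
proof (cases "(2::'a) = 0")
  case False
  then show ?thesis using Q0 sym_part_mmult_all[OF M N] by simp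
next
  case True
  then have Q: "Q0 = A_set R d 1" using Q0 by auto
  have "sym_part M a b = 0" if "b \<le> d" "b \<notin> Q0" for b
  proof -
    have b: "val b \<noteq> 1" using that Q by (auto simp: A_set_def)
    have "swp (rep_pt a) = rep_pt a" using a Q swp_fixed_iff[of "rep_pt a"] by (auto simp: A_set_def)
    then have "M (rep_pt a) (swp (rep_pt b)) = M (rep_pt a) (rep_pt b)" using swap_alg_swp[OF M, of "rep_pt a" "rep_pt b"] by simp
    then have "sym_part M a b = 2 * M (rep_pt a) (rep_pt b)" using block_sum[of b "M (rep_pt a)"] that b by (simp add: sym_part_def)
    with True show ?thesis by simp
  qed
  then have "(\<Sum>b\<in>Q0. sym_part M a b * sym_part N b c) = (\<Sum>b\<le>d. sym_part M a b * sym_part N b c)"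
    using Q0_le by (intro sum.mono_neutral_left) auto
  with sym_part_mmult_all[OF M N] show ?thesis by simp
qed

lemma alt_part_not_sim:
  assumes M: "M \<in> swap_alg" and "a \<le> d" "b \<le> d" "(a, b) \<notin> sim"
  shows "alt_part M a b = 0"
proof -
  have "M (swp (rep_pt a)) (rep_pt b) = M (rep_pt a) (rep_pt b)" using assms by (intro swap_alg_not_sim[OF M]) auto
  then show ?thesis by (simp add: alt_part_def swap_alg_swp_left[OF M])
qed

text \<open>The difference of two columns of \<open>N\<close> changes sign when \<open>w\<close>
  moves to its partner, so a two-point set contributes a single product of differences. One-point
  sets and sets outside the class contribute nothing, because \<open>alt_part\<close> vanishes off
  \<open>sim\<close>.\<close>

lemma alt_part_mmult:
  assumes M: "M \<in> swap_alg" and N: "N \<in> swap_alg" and C: "C \<in> A_set R d 2 // sim" and ac: "a \<in> C" "c \<in> C"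
  shows "alt_part (mmult M N) a c = (\<Sum>b\<in>C. alt_part M a b * alt_part N b c)"
proof -
  have Cs: "(a, b) \<in> sim \<longleftrightarrow> b \<in> C" for b
    using C ac(1) equiv_sim by (meson equiv_class_eq_iff in_quotient_imp_closed in_quotient_imp_in_rel quotient_eq_iff)
  have Cd: "b \<in> C \<Longrightarrow> b \<le> d \<and> val b = 2" for b using Cs simD by blast
  let ?f = "\<lambda>w. M (rep_pt a) w * (N w (rep_pt c) - N w (swp (rep_pt c)))"
  have blk: "(\<Sum>w | ix w = b. ?f w) = alt_part M a b * alt_part N b c" if b: "b \<le> d" for b
  proof -
    have "N (swp (rep_pt b)) (rep_pt c) = N (rep_pt b) (swp (rep_pt c))" "N (swp (rep_pt b)) (swp (rep_pt c)) = N (rep_pt b) (rep_pt c)"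
      using swap_alg_swp_left[OF N] swap_alg_swp[OF N] by auto
    moreover have "alt_part N b c = 0" if "val b = 1"
      using alt_part_not_sim[OF N b, of c] Cd[OF ac(2)] that simD by fastforce
    ultimately show ?thesis using block_sum[OF b, of ?f] by (auto simp: alt_part_def algebra_simps)
  qed
  have "alt_part (mmult M N) a c = (\<Sum>w\<in>UNIV. ?f w)"
    by (simp add: alt_part_def mmult_def sum_subtractf algebra_simps)
  also have "\<dots> = (\<Sum>b\<le>d. alt_part M a b * alt_part N b c)"
    unfolding sum_blocks[of ?f] by (intro sum.cong) (auto simp: blk)
  also have "\<dots> = (\<Sum>b\<in>C. alt_part M a b * alt_part N b c)"
    using Cd Cs alt_part_not_sim[OF M] ac(1) by (intro sum.mono_neutral_right) auto
  finally show ?thesis .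
qed

section \<open>The representation and its components\<close>

definition Idx :: "nat set option set" where
  "Idx = insert None (Some ` (A_set R d 2 // sim))"

text \<open>\<open>None\<close> plays the role of the index -1 of the theorem and carries the
  invariant action.\<close>

definition Qs :: "nat set option \<Rightarrow> nat set" where
  "Qs j = (case j of None \<Rightarrow> Q0 | Some C \<Rightarrow> C)"

definition rep :: "('x, 'a) xmat \<Rightarrow> nat set option \<Rightarrow> nat \<Rightarrow> nat \<Rightarrow> 'a" where
  "rep M j = enum_mat (Qs j) (case j of None \<Rightarrow> sym_part M | Some C \<Rightarrow> alt_part M)"

lemma finite_A2: "finite (A_set R d 2)"
  by (rule finite_subset[of _ "{..d}"]) (auto simp: A_set_def)

lemma class_subset: "C \<in> A_set R d 2 // sim \<Longrightarrow> C \<subseteq> A_set R d 2"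
  using Union_quotient[OF equiv_sim] by blast

lemma class_sim: "C \<in> A_set R d 2 // sim \<Longrightarrow> a \<in> C \<Longrightarrow> b \<in> C \<Longrightarrow> (a, b) \<in> sim"
  using in_quotient_imp_in_rel[OF equiv_sim] by blast

lemma class_Image: "C \<in> A_set R d 2 // sim \<Longrightarrow> a \<in> C \<Longrightarrow> sim `` {a} = C"
  using class_sim in_quotient_imp_closed[OF equiv_sim] by blast

lemma finite_Idx: "finite Idx"
  unfolding Idx_def using finite_quotient[OF finite_A2] equiv_type[OF equiv_sim] by simp

lemma finite_Qs: "j \<in> Idx \<Longrightarrow> finite (Qs j)"
proof (cases j)
  case None
  have "Q0 \<subseteq> {..d}" using Q0_le by auto
  then show ?thesis using None finite_subset by (auto simp: Qs_def)
next
  case (Some C)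
  assume "j \<in> Idx"
  with Some have "C \<subseteq> A_set R d 2" using class_subset by (auto simp: Idx_def)
  then show ?thesis using Some finite_A2 finite_subset by (auto simp: Qs_def)
qed

lemma sym_part_linear:
  "sym_part (M + N) a b = sym_part M a b + sym_part N a b" "sym_part (msmult c M) a b = c * sym_part M a b"
  by (simp_all add: sym_part_def sum.distrib msmult_def sum_distrib_left)

lemma alt_part_linear:
  "alt_part (M + N) a b = alt_part M a b + alt_part N a b" "alt_part (msmult c M) a b = c * alt_part M a b"
  by (simp_all add: alt_part_def msmult_def algebra_simps)

lemma swap_alg_closed:
  "0 \<in> swap_alg" "M \<in> swap_alg \<Longrightarrow> N \<in> swap_alg \<Longrightarrow> M + N \<in> swap_alg" "M \<in> swap_alg \<Longrightarrow> msmult c M \<in> swap_alg"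
  by (auto intro!: swap_algI simp: swap_alg_swp swap_alg_not_sim msmult_def)

text \<open>Placing the alternating values on pairs of equal orientation only produces the required
  differences without halving. The sole denominators are valencies of sets in \<open>Q0\<close>, so
  one proof fits every characteristic.\<close>

lemma rep_surjective:
  assumes B: "\<And>j. j \<in> Idx \<Longrightarrow> B j \<in> carrier (full_mat_alg (card (Qs j)))"
  shows "\<exists>M\<in>swap_alg. \<forall>j\<in>Idx. rep M j = B j"
proof -
  have "\<exists>G. \<forall>j\<in>Idx. enum_mat (Qs j) (G j) = B j"
    using enum_mat_surj[OF finite_Qs B] by metis
  then obtain G where G: "\<And>j. j \<in> Idx \<Longrightarrow> enum_mat (Qs j) (G j) = B j" by blast
  \<comment> \<open>The prescribed matrices of all classes are merged into one function, the class
    being recovered from the row index.\<close>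
  define H where "H a b = G (Some (sim `` {a})) a b" for a b
  \<comment> \<open>M1 has the prescribed alternating part; adding M0, whose blocks are constant, leaves that part
    unchanged and corrects the invariant part.\<close>
  define M1 :: "('x, 'a) xmat" where
    "M1 y z = (if (ix y, ix z) \<in> sim \<and> oriented y = oriented z then H (ix y) (ix z) else 0)" for y z
  define M0 :: "('x, 'a) xmat" where
    "M0 y z = (if ix y \<in> Q0 \<and> ix z \<in> Q0
      then (G None (ix y) (ix z) - sym_part M1 (ix y) (ix z)) / of_nat (val (ix z)) else 0)" for y z
  have "M1 \<in> swap_alg"
    by (rule swap_algI) (auto simp: M1_def oriented_swp dest: simD)
  moreover have "M0 \<in> swap_alg" by (rule swap_algI) (auto simp: M0_def)
  ultimately have "M0 + M1 \<in> swap_alg" by (rule swap_alg_closed(2)[rotated])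
  moreover have "rep (M0 + M1) j = B j" if j: "j \<in> Idx" for j
  proof (cases j)
    case None
    have "sym_part (M0 + M1) a b = G None a b" if "a \<in> Q0" "b \<in> Q0" for a b
    proof -
      have "sym_part M0 a b = (\<Sum>z | ix z = b. (G None a b - sym_part M1 a b) / of_nat (val b))"
        unfolding sym_part_def[of M0] using that Q0_le by (intro sum.cong) (auto simp: M0_def)
      also have "\<dots> = G None a b - sym_part M1 a b"
        using Q0_val[OF that(2)] val_eq[OF Q0_le[OF that(2)], of x] by simp
      finally show ?thesis by (simp add: sym_part_linear)
    qed
    then have "enum_mat Q0 (sym_part (M0 + M1)) = enum_mat Q0 (G None)"
      using finite_Qs[OF j] None by (subst enum_mat_eq_iff) (auto simp: Qs_def)
    then show ?thesis using G[OF j] None by (simp add: rep_def Qs_def)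
  next
    case (Some C)
    then have C: "C \<in> A_set R d 2 // sim" using j by (auto simp: Idx_def)
    have "alt_part (M0 + M1) a b = G (Some C) a b" if "a \<in> C" "b \<in> C" for a b
    proof -
      have ab: "(a, b) \<in> sim" "sim `` {a} = C" using C that class_sim class_Image by auto
      then have *: "a \<le> d" "b \<le> d" "val b = 2" using simD by auto
      then have "alt_part M0 a b = 0" by (simp add: alt_part_def M0_def)
      moreover have "alt_part M1 a b = G (Some C) a b"
        using ab * oriented_swp[of "rep_pt b"] by (simp add: alt_part_def M1_def H_def)
      ultimately show ?thesis by (simp add: alt_part_linear)
    qed
    then have "enum_mat C (alt_part (M0 + M1)) = enum_mat C (G (Some C))"
      using finite_Qs[OF j] Some by (subst enum_mat_eq_iff) (auto simp: Qs_def)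
    then show ?thesis using G[OF j] Some by (simp add: rep_def Qs_def)
  qed
  ultimately show ?thesis by blast
qed

sublocale mat_block_hom "swap_alg :: ('x, 'a) xmat set" Idx "\<lambda>j. card (Qs j)" rep
proof (unfold_locales, unfold mat_alg_simps, goal_cases)
  case 1 show ?case by (rule finite_Idx)
next
  case (2 j)
  then have "Qs j \<noteq> {}" using Q0_nonempty in_quotient_imp_non_empty[OF equiv_sim]
    by (auto simp: Idx_def Qs_def)
  with finite_Qs[OF 2] show ?case by (simp add: card_gt_0_iff)
next
  case 3 show ?case by (rule swap_alg_closed)
next
  case 4 then show ?case by (rule swap_alg_closed)
next
  case 5 then show ?case by (rule mmult_in_swap_alg)
next
  case 6 then show ?case by (rule swap_alg_closed)
next
  case (7 M j)
  show ?case unfolding rep_def by (rule enum_mat_carrier)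
next
  case (8 j)
  have "sym_part 0 a b = 0" "alt_part 0 a b = 0" for a b by (simp_all add: sym_part_def alt_part_def)
  then show ?case unfolding rep_def enum_mat_def by (auto simp: fun_eq_iff split: option.splits)
next
  case (9 M N j)
  show ?case unfolding rep_def enum_mat_def
    by (auto simp: fun_eq_iff sym_part_linear alt_part_linear split: option.splits)
next
  case (10 M N j)
  show ?case
  proof (cases j)
    case None
    show ?thesis unfolding rep_def using 10 None
      by (intro enum_mat_mult finite_Qs) (auto simp: Qs_def sym_part_mmult)
  next
    case (Some C)
    show ?thesis unfolding rep_def using 10 Some
      by (intro enum_mat_mult finite_Qs) (auto simp: Qs_def alt_part_mmult Idx_def)
  qed
next
  case (11 M j c)
  show ?case unfolding rep_def enum_mat_def
    by (auto simp: fun_eq_iff sym_part_linear alt_part_linear split: option.splits)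
next
  case (12 B)
  then show ?case by (rule rep_surjective)
qed

section \<open>The kernel, according to the characteristic\<close>

lemma in_ker_iff: "M \<in> ker \<longleftrightarrow> M \<in> swap_alg \<and> (\<forall>a\<in>Q0. \<forall>b\<in>Q0. sym_part M a b = 0) \<and> (\<forall>(a, b)\<in>sim. alt_part M a b = 0)"
proof -
  have z: "0 = enum_mat Q (\<lambda>_ _. 0 :: 'a)" for Q :: "nat set" by (auto simp: enum_mat_def fun_eq_iff)
  have "(\<forall>j\<in>Idx. rep M j = 0) \<longleftrightarrow> (\<forall>a\<in>Q0. \<forall>b\<in>Q0. sym_part M a b = 0) \<and>
      (\<forall>C\<in>A_set R d 2 // sim. \<forall>a\<in>C. \<forall>b\<in>C. alt_part M a b = 0)"
  proof -
    have "rep M None = 0 \<longleftrightarrow> (\<forall>a\<in>Q0. \<forall>b\<in>Q0. sym_part M a b = 0)"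
      using finite_Qs[of None] by (simp add: rep_def Qs_def Idx_def z[of Q0] enum_mat_eq_iff)
    moreover have "rep M (Some C) = 0 \<longleftrightarrow> (\<forall>a\<in>C. \<forall>b\<in>C. alt_part M a b = 0)" if "C \<in> A_set R d 2 // sim" for C
      using finite_Qs[of "Some C"] that by (simp add: rep_def Qs_def Idx_def z[of C] enum_mat_eq_iff)
    ultimately show ?thesis by (auto simp: Idx_def)
  qed
  also have "(\<forall>C\<in>A_set R d 2 // sim. \<forall>a\<in>C. \<forall>b\<in>C. alt_part M a b = 0) \<longleftrightarrow> (\<forall>(a, b)\<in>sim. alt_part M a b = 0)"
  proof safe
    fix a b assume *: "\<forall>C\<in>A_set R d 2 // sim. \<forall>a\<in>C. \<forall>b\<in>C. alt_part M a b = 0" "(a, b) \<in> sim"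
    then have "a \<in> A_set R d 2" using simD by (auto simp: A_set_def)
    then have "sim `` {a} \<in> A_set R d 2 // sim" "a \<in> sim `` {a}"
      using equiv_class_self[OF equiv_sim] by (auto intro: quotientI)
    with * show "alt_part M a b = 0" by blast
  qed (use class_sim in blast)
  finally show ?thesis unfolding ker_def by blast
qed

text \<open>In a base row, the sum and the difference of the two entries over a two-point set both
  vanish, hence so do the entries. Commuting with the involution carries this to the other
  rows.\<close>

lemma ker_trivial:
  assumes "(2::'a) \<noteq> 0" and M: "M \<in> ker"
  shows "M = 0"
proof -
  have swap_alg: "M \<in> swap_alg" and sym_part: "\<And>a b. a \<le> d \<Longrightarrow> b \<le> d \<Longrightarrow> sym_part M a b = 0" and alt_part: "\<And>a b. (a, b) \<in> sim \<Longrightarrow> alt_part M a b = 0"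
    using M assms(1) Q0 unfolding in_ker_iff by auto
  have r: "M (rep_pt a) (rep_pt b) = 0 \<and> M (rep_pt a) (swp (rep_pt b)) = 0" if ab: "a \<le> d" "b \<le> d" for a b
  proof (cases "val b = 1")
    case True
    then show ?thesis using sym_part[OF ab] block_sum[of b "M (rep_pt a)"] swp_fixed_iff[of "rep_pt b"] ab
      by (auto simp: sym_part_def)
  next
    case False
    then have "M (rep_pt a) (rep_pt b) + M (rep_pt a) (swp (rep_pt b)) = 0"
      using sym_part[OF ab] block_sum[of b "M (rep_pt a)"] ab by (simp add: sym_part_def)
    moreover have "M (rep_pt a) (rep_pt b) = M (rep_pt a) (swp (rep_pt b))"
      using alt_part[of a b] alt_part_not_sim[OF swap_alg ab] by (auto simp: alt_part_def)
    ultimately have "2 * M (rep_pt a) (rep_pt b) = 0" "M (rep_pt a) (rep_pt b) = M (rep_pt a) (swp (rep_pt b))" by auto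
    with assms(1) show ?thesis by auto
  qed
  have "M y z = 0" for y z
    using oriented_cases[of y] oriented_cases[of z] r[of "ix y" "ix z"] swap_alg_swp[OF swap_alg, of "rep_pt (ix y)" "rep_pt (ix z)"]
      swap_alg_swp_left[OF swap_alg, of "rep_pt (ix y)" "rep_pt (ix z)"] by (metis rel_of_le)
  then show ?thesis by (simp add: fun_eq_iff)
qed

text \<open>A kernel element is constant on every block: on similar pairs because its alternating
  part is zero, elsewhere because it lies in \<open>swap_alg\<close>. Summing over a two-point set
  doubles a term, so products run through one-point sets only. Two factors may still join two-point
  sets through a one-point set; with three, the middle factor is read between one-point sets, where
  it is zero.\<close>

lemma ker_nilpotent:
  assumes two: "(2::'a) = 0" and ker: "M \<in> ker" "N \<in> ker" "L \<in> ker"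
  shows "mmult M (mmult N L) = 0"
proof -
  have Q: "Q0 = A_set R d 1" using Q0 two by auto
  have inv: "K y (swp z) = K y z" "K (swp y) z = K y z" if K: "K \<in> ker" for K y z
  proof -
    have swap_alg: "K \<in> swap_alg" using K by (simp add: in_ker_iff)
    show *: "K y (swp z) = K y z" for y z
    proof (cases "(ix y, ix z) \<in> sim")
      case True
      then have "alt_part K (ix y) (ix z) = 0" using K by (auto simp: in_ker_iff)
      then show ?thesis unfolding alt_part_def
        using oriented_cases[of y] oriented_cases[of z] swap_alg_swp[OF swap_alg, of "rep_pt (ix y)" "rep_pt (ix z)"]
          swap_alg_swp_left[OF swap_alg, of "rep_pt (ix y)" "rep_pt (ix z)"] swap_alg_swp_left[OF swap_alg]
        by (metis eq_iff_diff_eq_0 swp_swp)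
    next
      case False
      then show ?thesis using swap_alg_swp_left[OF swap_alg, of y z] swap_alg_not_sim[OF swap_alg False] by simp
    qed
    show "K (swp y) z = K y z" using swap_alg_swp_left[OF swap_alg] * by simp
  qed
  have prod: "mmult K K' y z = (\<Sum>b\<in>A_set R d 1. K y (rep_pt b) * K' (rep_pt b) z)"
    if K: "K \<in> ker" "K' \<in> ker" for K K' y z
  proof -
    have "mmult K K' y z = (\<Sum>b\<le>d. \<Sum>w | ix w = b. K y w * K' w z)"
      unfolding mmult_def by (rule sum_blocks)
    also have "\<dots> = (\<Sum>b\<le>d. if val b = 1 then K y (rep_pt b) * K' (rep_pt b) z else 0)"
    proof (intro sum.cong refl)
      fix b assume "b \<in> {..d}"
      then have "(\<Sum>w | ix w = b. K y w * K' w z) = (if val b = 1 then K y (rep_pt b) * K' (rep_pt b) z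
          else 2 * (K y (rep_pt b) * K' (rep_pt b) z))"
        by (simp add: block_sum inv[OF K(1)] inv[OF K(2)])
      then show "(\<Sum>w | ix w = b. K y w * K' w z) = (if val b = 1 then K y (rep_pt b) * K' (rep_pt b) z else 0)"
        using two by simp
    qed
    also have "\<dots> = (\<Sum>b\<in>{b \<in> {..d}. val b = 1}. K y (rep_pt b) * K' (rep_pt b) z)"
      by (rule sum.inter_filter[symmetric]) simp
    also have "{b \<in> {..d}. val b = 1} = A_set R d 1" by (auto simp: A_set_def)
    finally show ?thesis .
  qed
  have zero: "K (rep_pt a) (rep_pt b) = 0" if "K \<in> ker" "a \<in> A_set R d 1" "b \<in> A_set R d 1" for K a b
  proof -
    have "sym_part K a b = 0" using that unfolding in_ker_iff Q[symmetric] by blast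
    then show ?thesis using block_sum[of b "K (rep_pt a)"] that by (simp add: sym_part_def A_set_def)
  qed
  \<comment> \<open>Needed to apply \<open>prod\<close> to the outer product as well as to the inner
    one.\<close>
  have "mmult N L \<in> ker" using ker ker_closed(4) by (simp add: in_ker_iff)
  then have "mmult M (mmult N L) y z = 0" for y z
    using ker by (simp add: prod zero)
  then show ?thesis by (simp add: fun_eq_iff)
qed

end

section \<open>Assembly of the thin case and of the two cases of characteristic\<close>

theorem theoremE:
  fixes R :: "nat \<Rightarrow> ('x::finite \<times> 'x) set"
    and d :: nat
    and x :: 'x
  assumes scheme: "is_scheme R d"
    and qthin: "quasi_thin R d"
  defines "T \<equiv> mat_alg (terwilliger R d x :: ('x, 'a::field) xmat set)"
  shows
    "(thin R d \<longrightarrow> alg_iso T (full_mat_alg (card (UNIV :: 'x set)) :: ('a, nat \<Rightarrow> nat \<Rightarrow> 'a) falg)) \<and>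
     (\<not> thin R d \<longrightarrow>
        equiv (A_set R d 2) (sim_rel R d) \<and>
        (CHAR('a) \<noteq> 2 \<longrightarrow>
           (\<exists>I :: nat set option \<Rightarrow> ('x, 'a) xmat set.
              (\<forall>j\<in>insert None (Some ` (A_set R d 2 // sim_rel R d)).
                  minimal_ideal T (I j) \<and> unital_alg (restrict_alg T (I j))) \<and>
              simple_alg (restrict_alg T (I None)) \<and>
              vector_space.dim msmult (I None) = (d + 1)^2 \<and>
              internal_direct_sum T (insert None (Some ` (A_set R d 2 // sim_rel R d))) I \<and>
              (\<forall>C\<in>A_set R d 2 // sim_rel R d.
                  alg_iso (restrict_alg T (I (Some C)))
                          (full_mat_alg (card C) :: ('a, nat \<Rightarrow> nat \<Rightarrow> 'a) falg)))) \<and>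
        (CHAR('a) = 2 \<longrightarrow>
           (\<exists>K :: nat set option \<Rightarrow> ('x, 'a) xmat set set.
              (\<forall>u\<in>insert None (Some ` (A_set R d 2 // sim_rel R d)).
                  minimal_ideal (quot_alg T (jacobson T)) (K u) \<and>
                  unital_alg (restrict_alg (quot_alg T (jacobson T)) (K u))) \<and>
              internal_direct_sum (quot_alg T (jacobson T))
                 (insert None (Some ` (A_set R d 2 // sim_rel R d))) K \<and>
              alg_iso (restrict_alg (quot_alg T (jacobson T)) (K None))
                      (full_mat_alg (card (A_set R d 1)) :: ('a, nat \<Rightarrow> nat \<Rightarrow> 'a) falg) \<and>
              (\<forall>C\<in>A_set R d 2 // sim_rel R d.
                  alg_iso (restrict_alg (quot_alg T (jacobson T)) (K (Some C)))
                          (full_mat_alg (card C) :: ('a, nat \<Rightarrow> nat \<Rightarrow> 'a) falg)))))"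
proof -
  interpret qt_scheme R d x by unfold_locales (fact scheme qthin)+
  \<comment> \<open>The locale distinguishes whether 2 vanishes in the field. That happens exactly
    if the characteristic divides 2, and it is never 1.\<close>
  have two: "(2::'a) = 0 \<longleftrightarrow> CHAR('a) = 2"
  proof -
    have "(2::'a) = 0 \<longleftrightarrow> CHAR('a) dvd 2" using of_nat_eq_0_iff_char_dvd[of 2, where 'a='a] by simp
    also have "\<dots> \<longleftrightarrow> CHAR('a) = 2"
    proof
      assume "CHAR('a) dvd 2"
      then have "CHAR('a) \<le> 2" "CHAR('a) \<noteq> 0"
        using dvd_imp_le[of "CHAR('a)" 2] dvd_0_left[of "2::nat"] by fastforce+
      then show "CHAR('a) = 2" using CHAR_not_1[where 'a='a] by linarith
    qed simp
    finally show ?thesis .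
  qed
  let ?Idx = "insert None (Some ` (A_set R d 2 // sim_rel R d))"
  have "alg_iso T (full_mat_alg (card (UNIV :: 'x set)) :: ('a, nat \<Rightarrow> nat \<Rightarrow> 'a) falg)" if "thin R d"
    unfolding T_def thin_terwilliger[OF that] by (rule alg_iso_all_matrices)
  moreover have "\<exists>I :: nat set option \<Rightarrow> ('x, 'a) xmat set.
      (\<forall>j\<in>?Idx. minimal_ideal T (I j) \<and> unital_alg (restrict_alg T (I j))) \<and>
      simple_alg (restrict_alg T (I None)) \<and> vector_space.dim msmult (I None) = (d + 1)^2 \<and>
      internal_direct_sum T ?Idx I \<and>
      (\<forall>C\<in>A_set R d 2 // sim_rel R d.
        alg_iso (restrict_alg T (I (Some C))) (full_mat_alg (card C) :: ('a, nat \<Rightarrow> nat \<Rightarrow> 'a) falg))"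
    if "CHAR('a) \<noteq> 2"
  proof -
    interpret F: qt_scheme_field R d x "TYPE('a)" "{..d}"
      using that two by unfold_locales auto
    have T: "T = mat_alg swap_alg" by (simp add: T_def terwilliger_eq)
    interpret B: block_rep T F.Idx "\<lambda>j. card (F.Qs j)" F.rep
    proof -
      have "block_hom T F.Idx (\<lambda>j. card (F.Qs j)) F.rep" unfolding T by (rule F.block_hom_axioms)
      moreover have "M = N" if "M \<in> carrier T" "N \<in> carrier T" "\<And>j. j \<in> F.Idx \<Longrightarrow> F.rep M j = F.rep N j" for M N
      proof -
        \<comment> \<open>Away from characteristic 2 the kernel is zero, so the components determine
          the matrix.\<close>
        have "M - N \<in> F.ker" using that by (auto simp: F.ker_def T F.diff_in_T F.rep_diff)
        with F.ker_trivial \<open>CHAR('a) \<noteq> 2\<close> two show ?thesis by fastforce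
      qed
      ultimately show "block_rep T F.Idx (\<lambda>j. card (F.Qs j)) F.rep"
        by (intro block_rep.intro block_rep_axioms.intro) blast+
    qed
    have None: "None \<in> F.Idx" by (simp add: F.Idx_def)
    \<comment> \<open>The dimension is that of the ideal as a subspace of all matrices; its matrix
      size is \<open>card {..d}\<close>, that is \<open>d + 1\<close>.\<close>
    have "xmat.subspace (B.block None)"
      using B.two_sided_ideal_block[of None]
      unfolding two_sided_ideal_def subspace_of_def xmat.subspace_def T by simp
    then have "vector_space.dim (msmult :: 'a \<Rightarrow> _) (B.block None) = (card (F.Qs None))^2"
      by (rule xmat_dim_square[OF _ B.alg_iso_block(1)[OF None]])
        (use B.rep_add[OF _ _ None] B.rep_smul[OF _ None] B.block_carrier in \<open>auto simp: T\<close>)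
    moreover have "card (F.Qs None) = d + 1" by (simp add: F.Qs_def)
    moreover have "alg_iso (restrict_alg T (B.block (Some C))) (full_mat_alg (card C) :: ('a, nat \<Rightarrow> nat \<Rightarrow> 'a) falg)"
      if "C \<in> A_set R d 2 // sim_rel R d" for C
      using B.alg_iso_block(2)[of "Some C"] that by (simp add: F.Idx_def F.Qs_def)
    ultimately show ?thesis
      using B.minimal_ideal_block B.unital_alg_block B.simple_alg_block[OF None] B.internal_direct_sum_block
      unfolding F.Idx_def[symmetric] by (intro exI[of _ B.block]) auto
  qed
  moreover have "\<exists>K :: nat set option \<Rightarrow> ('x, 'a) xmat set set.
      (\<forall>u\<in>?Idx. minimal_ideal (quot_alg T (jacobson T)) (K u) \<and>
        unital_alg (restrict_alg (quot_alg T (jacobson T)) (K u))) \<and>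
      internal_direct_sum (quot_alg T (jacobson T)) ?Idx K \<and>
      alg_iso (restrict_alg (quot_alg T (jacobson T)) (K None))
        (full_mat_alg (card (A_set R d 1)) :: ('a, nat \<Rightarrow> nat \<Rightarrow> 'a) falg) \<and>
      (\<forall>C\<in>A_set R d 2 // sim_rel R d.
        alg_iso (restrict_alg (quot_alg T (jacobson T)) (K (Some C)))
          (full_mat_alg (card C) :: ('a, nat \<Rightarrow> nat \<Rightarrow> 'a) falg))"
    if "CHAR('a) = 2"
  proof -
    interpret F: qt_scheme_field R d x "TYPE('a)" "A_set R d 1"
      using that two by unfold_locales auto
    have T: "T = mat_alg swap_alg" by (simp add: T_def terwilliger_eq)
    \<comment> \<open>Once the radical is identified with the kernel, the quotient of the statement
      is the faithful one from \<open>block_rep_quot\<close>.\<close>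
    have J: "jacobson T = F.ker" unfolding T
      by (rule F.jacobson_eq_ker[OF mone_in_swap_alg]) (use F.ker_nilpotent that two in auto)
    interpret B: block_rep "quot_alg T (jacobson T)" F.Idx "\<lambda>j. card (F.Qs j)" "\<lambda>C. F.rep (SOME M. M \<in> C)"
      unfolding J unfolding T by (rule F.block_rep_quot)
    have "alg_iso (restrict_alg (quot_alg T (jacobson T)) (B.block None))
        (full_mat_alg (card (A_set R d 1)) :: ('a, nat \<Rightarrow> nat \<Rightarrow> 'a) falg)"
    proof -
      have "None \<in> F.Idx" unfolding F.Idx_def by simp
      moreover have "F.Qs None = A_set R d 1" unfolding F.Qs_def by simp
      ultimately show ?thesis using B.alg_iso_block(2)[of None] by metis
    qed
    moreover have "alg_iso (restrict_alg (quot_alg T (jacobson T)) (B.block (Some C)))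
        (full_mat_alg (card C) :: ('a, nat \<Rightarrow> nat \<Rightarrow> 'a) falg)"
      if "C \<in> A_set R d 2 // sim_rel R d" for C
    proof -
      have "Some C \<in> F.Idx" using that unfolding F.Idx_def by simp
      moreover have "F.Qs (Some C) = C" unfolding F.Qs_def by simp
      ultimately show ?thesis using B.alg_iso_block(2)[of "Some C"] by metis
    qed
    ultimately show ?thesis
      using B.minimal_ideal_block B.unital_alg_block B.internal_direct_sum_block
      unfolding F.Idx_def[symmetric] by (intro exI[of _ B.block]) auto
  qed
  ultimately show ?thesis using equiv_sim by blast
qed

end
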